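(* Let $\phi=\frac{1+\sqrt5}{2}$ be the golden ratio. For a universal constant $C>0$, there exist monotone paths of length $>C\cdot\phi^n$ on the perfect 2-matching polytope of $K_n$ and on the traveling salesman polytope (TSP) with $n$ nodes.
   Context: A perfect 2-matching of the complete graph $K_n$ is a set of edges such that every vertex is incident to exactly 2 of them (a union of disjoint cycles covering all nodes). The perfect 2-matching polytope is the convex hull of the 0/1 incidence vectors (indexed by the edges of $K_n$) of perfect 2-matchings. The traveling salesman polytope (TSP) on $n$ nodes is the convex hull of the incidence vectors of tours, i.e. (undirected) cycles of length $n$ in $K_n$. For a polytope $Q$, a linear objective $c$ (to be minimized) is nondegenerate if no two vertices have the same objective value; each edge of $Q$ is oriented toward its endpoint of smaller value. A monotone path (for $c$) is a directed path in this oriented graph from some vertex to the optimal vertex, for some nondegenerate $c$; its length is its number of edges. *)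

theory Defs
  imports "HOL-Analysis.Analysis" "HOL-Analysis.Finite_Function_Topology"
begin

text \<open>
  Since \<open>n\<close> is quantified inside the statement (below the universal constant), \<open>\<real>\<close> to the power
  \<open>E(K\<^sub>n)\<close> is not modelled as a type depending on \<open>n\<close>.  All these spaces are regarded as
  coordinate subspaces of the single real vector space \<open>(nat set, real) poly_mapping\<close> of finitely supported
  vectors, whose coordinates are indexed by potential edges.  Vertices, faces and edges of a
  polytope do not depend on the ambient space, and the linear functionals on a coordinate
  subspace are exactly the restrictions of the linear functionals on the whole space.
\<close>

type_synonym edge_vec = "(nat set, real) poly_mapping"

definition complete_edges :: "nat \<Rightarrow> nat set set" where
  "complete_edges n = {{u, v} | u v. u < n \<and> v < n \<and> u \<noteq> v}"

definition incidence_vec :: "nat set set \<Rightarrow> edge_vec" where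
  "incidence_vec M = (\<Sum>e\<in>M. Poly_Mapping.single e 1)"

definition perfect_2_matching :: "nat \<Rightarrow> nat set set \<Rightarrow> bool" where
  "perfect_2_matching n M \<longleftrightarrow>
     M \<subseteq> complete_edges n \<and> (\<forall>v<n. card {e \<in> M. v \<in> e} = 2)"

text \<open>The bound \<open>3 \<le> n\<close> excludes the degenerate closed walks on fewer than three nodes.\<close>

definition tour :: "nat \<Rightarrow> nat set set \<Rightarrow> bool" where
  "tour n M \<longleftrightarrow> 3 \<le> n \<and>
     (\<exists>xs. distinct xs \<and> set xs = {..<n} \<and> M = {{xs ! i, xs ! (Suc i mod n)} | i. i < n})"

definition perfect_2_matching_polytope :: "nat \<Rightarrow> edge_vec set" where
  "perfect_2_matching_polytope n = convex hull (incidence_vec ` {M. perfect_2_matching n M})"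

definition tsp_polytope :: "nat \<Rightarrow> edge_vec set" where
  "tsp_polytope n = convex hull (incidence_vec ` {M. tour n M})"

definition vertices_of :: "'a::real_vector set \<Rightarrow> 'a set" where
  "vertices_of Q = {v. v extreme_point_of Q}"

text \<open>
  The library's \<open>edge_of\<close> (a face of affine dimension 1) is restricted to Euclidean spaces.
  The following version, with the endpoints as arguments, makes sense in any real vector space;
  the lemma \<open>edge_of_iff_edge_between\<close> relates the two.
\<close>

definition edge_between :: "'a::real_vector set \<Rightarrow> 'a \<Rightarrow> 'a \<Rightarrow> bool" where
  "edge_between Q u v \<longleftrightarrow> u \<noteq> v \<and> closed_segment u v face_of Q"

lemma edge_of_iff_edge_between:
  fixes Q :: "'a::euclidean_space set"
  assumes "polytope Q"
  shows "F edge_of Q \<longleftrightarrow> (\<exists>u v. edge_between Q u v \<and> F = closed_segment u v)"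
proof
  assume F: "F edge_of Q"
  then have face: "F face_of Q" and dim: "aff_dim F = 1"
    by (auto simp: edge_of_def)
  have "compact F" "convex F"
    using face assms by (auto intro: polytope_imp_compact face_of_polytope_polytope face_of_imp_convex)
  moreover have "collinear F" "F \<noteq> {}"
    using dim by (auto simp: collinear_aff_dim)
  ultimately obtain u v where uv: "F = closed_segment u v"
    using compact_convex_collinear_segment by blast
  then have "u \<noteq> v"
    using dim by auto
  with uv face show "\<exists>u v. edge_between Q u v \<and> F = closed_segment u v"
    by (auto simp: edge_between_def)
next
  assume "\<exists>u v. edge_between Q u v \<and> F = closed_segment u v"
  then show "F edge_of Q"
    by (auto simp: edge_of_def edge_between_def segment_convex_hull aff_dim_convex_hull aff_dim_2)
qed

definition nondegenerate_objective :: "'a::real_vector set \<Rightarrow> ('a \<Rightarrow> real) \<Rightarrow> bool" where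
  "nondegenerate_objective Q c \<longleftrightarrow> linear c \<and> inj_on c (vertices_of Q)"

definition optimal_vertex :: "'a::real_vector set \<Rightarrow> ('a \<Rightarrow> real) \<Rightarrow> 'a \<Rightarrow> bool" where
  "optimal_vertex Q c v \<longleftrightarrow> v \<in> vertices_of Q \<and> (\<forall>w\<in>vertices_of Q. c v \<le> c w)"

definition oriented_edge :: "'a::real_vector set \<Rightarrow> ('a \<Rightarrow> real) \<Rightarrow> 'a \<Rightarrow> 'a \<Rightarrow> bool" where
  "oriented_edge Q c u v \<longleftrightarrow> edge_between Q u v \<and> c v < c u"

definition monotone_path_for :: "'a::real_vector set \<Rightarrow> ('a \<Rightarrow> real) \<Rightarrow> 'a list \<Rightarrow> bool" where
  "monotone_path_for Q c p \<longleftrightarrow>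
     p \<noteq> [] \<and> set p \<subseteq> vertices_of Q \<and> successively (oriented_edge Q c) p \<and>
     optimal_vertex Q c (last p)"

definition monotone_path :: "'a::real_vector set \<Rightarrow> 'a list \<Rightarrow> bool" where
  "monotone_path Q p \<longleftrightarrow> (\<exists>c. nondegenerate_objective Q c \<and> monotone_path_for Q c p)"

text \<open>A path is given by its list of vertices; its length is the number of its edges.\<close>

definition path_len :: "'a list \<Rightarrow> nat" where
  "path_len p = length p - 1"

definition golden_ratio :: real where
  "golden_ratio = (1 + sqrt 5) / 2"

end

theory Submission
  imports Defs
begin

text \<open>
  Let \<open>N = n div 2\<close> and force \<open>N\<close> disjoint paths into the tour, the \<open>i\<close>-th one ending in the vertex \<open>2 i\<close>;
  the tours through these paths are the cyclic permutations of \<open>{0..<N}\<close>, and an objective with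
  rapidly decreasing weights compares two of them lexicographically by the successors of
  \<open>0, 1, 2, \<dots>\<close>. If the successors of two cyclic permutations differ by a single cycle, then their
  tours are adjacent on both polytopes. From every cyclic permutation in which \<open>i\<close> can still move to
  a smaller successor, one such exchange (of 3, 5 or 7 arcs) decreases the successor of \<open>i\<close>, keeps
  those below \<open>i\<close>, and raises the successor of \<open>i + 1\<close> to one of its six largest possible values.
  With \<open>m = N - i\<close> the resulting path lengths satisfy \<open>g m = (m - 7) (1 + g (m - 1))\<close>, hence
  \<open>g N \<ge> (N - 7)!\<close>, which beats \<open>3\<^sup>N\<close> and so \<open>\<phi>\<^sup>n\<close>. The path is continued by 3-exchanges to
  the tour \<open>0, 1, \<dots>, n - 1\<close>, which is optimal even among the perfect 2-matchings.
\<close>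

section \<open>Faces of convex hulls of incidence vectors\<close>

text \<open>Edges of K_n forget direction, whereas the descent is about successors. A path with an
  odd first and an even last vertex restores it: an arc between two nodes becomes an edge from an
  even to an odd vertex, which can be read in only one way. The price, half as many nodes as
  vertices, is harmless against a factorial. The obstacle is adjacency: a 2-matching between two
  tours may consist of several cycles. Demanding that the changed arcs form one orbit leaves it only
  the choice between all old and all new arcs. The successor maps of two cyclic permutations have
  the same sign, so an exchange that is a single cycle involves an odd number of arcs; this is why
  3, 5 and 7 occur. The 7 in the recursion is 6 + 1. Steering the successor of \<open>i + 1\<close>
  needs four candidates for the arc whose head it takes over; two further targets are allowed for
  because \<open>i\<close> and \<open>i + 1\<close> themselves cannot be candidates, hence six. One
  more of the remaining smaller successors may be lost because it closes a short cycle.\<close>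

lemma face_of_convex_hull_minimizers:
  fixes V :: "'a::real_vector set" and f :: "'a \<Rightarrow> real"
  assumes fin: "finite V" and lin: "linear f" and ge: "\<And>x. x \<in> V \<Longrightarrow> m \<le> f x"
  shows "convex hull {x \<in> V. f x = m} face_of convex hull V"
proof -
  have ge': "m \<le> f x" if "x \<in> convex hull V" for x
  proof -
    have "convex {x. m \<le> f x}"
      using convex_linear_vimage[OF lin convex_real_interval(1), of m] by (simp add: vimage_def)
    then have "convex hull V \<subseteq> {x. m \<le> f x}" using ge by (intro hull_minimal) auto
    then show ?thesis using that by auto
  qed
  have eq: "convex hull {x \<in> V. f x = m} = {x \<in> convex hull V. f x = m}"
  proof
    have "convex {x. f x = m}"
      using convex_linear_vimage[OF lin convex_singleton, of m] by (simp add: vimage_def)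
    then have "convex hull {x \<in> V. f x = m} \<subseteq> {x. f x = m}" by (intro hull_minimal) auto
    then show "convex hull {x \<in> V. f x = m} \<subseteq> {x \<in> convex hull V. f x = m}"
      using hull_mono[of "{x \<in> V. f x = m}" V convex] by auto
    show "{x \<in> convex hull V. f x = m} \<subseteq> convex hull {x \<in> V. f x = m}"
    proof
      fix x assume x: "x \<in> {x \<in> convex hull V. f x = m}"
      then obtain u where u: "\<forall>y\<in>V. 0 \<le> u y" "sum u V = 1" "(\<Sum>y\<in>V. u y *\<^sub>R y) = x"
        using fin by (auto simp: convex_hull_finite)
      \<comment> \<open>The excess over \<open>m\<close> is averaged with the same coefficients. At
        value \<open>m\<close> a sum of nonnegative terms vanishes, so only minimizers carry
        weight.\<close>
      have "(\<Sum>y\<in>V. u y * (f y - m)) = f x - m"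
        using u by (simp add: u(3)[symmetric] linear_sum[OF lin] linear_cmul[OF lin] right_diff_distrib sum_subtractf sum_distrib_right[symmetric])
      then have "(\<Sum>y\<in>V. u y * (f y - m)) = 0" using x by simp
      then have "\<forall>y\<in>V. u y * (f y - m) = 0"
        using u(1) ge fin by (subst (asm) sum_nonneg_eq_0_iff) auto
      then have z: "u y = 0" if "y \<in> V - {x \<in> V. f x = m}" for y using that by auto
      have "sum u {x \<in> V. f x = m} = 1"
        using u(2) z sum.mono_neutral_right[of V "{x \<in> V. f x = m}" u] fin by auto
      moreover have "(\<Sum>y\<in>{x \<in> V. f x = m}. u y *\<^sub>R y) = x"
        using u(3) z sum.mono_neutral_right[of V "{x \<in> V. f x = m}" "\<lambda>y. u y *\<^sub>R y"] fin by auto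
      ultimately show "x \<in> convex hull {x \<in> V. f x = m}"
        using u(1) fin by (auto simp: convex_hull_finite)
    qed
  qed
  show ?thesis unfolding face_of_def
  proof (intro conjI ballI impI)
    show "convex hull {x \<in> V. f x = m} \<subseteq> convex hull V" by (intro hull_mono) auto
    fix a b x assume a: "a \<in> convex hull V" and b: "b \<in> convex hull V"
      and x: "x \<in> convex hull {x \<in> V. f x = m}" "x \<in> open_segment a b"
    obtain t where t: "0 < t" "t < 1" "x = (1 - t) *\<^sub>R a + t *\<^sub>R b" using x(2) by (auto simp: in_segment)
    have "f x = (1 - t) * f a + t * f b"
      by (simp only: t(3) linear_add[OF lin] linear_cmul[OF lin] real_scaleR_def)
    moreover have "f x = m" using x(1) eq by auto
    ultimately have "(1 - t) * (f a - m) + t * (f b - m) = 0"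
      by (simp add: algebra_simps)
    moreover have "0 \<le> (1 - t) * (f a - m)" "0 \<le> t * (f b - m)" using ge'[OF a] ge'[OF b] t by auto
    ultimately have "(1 - t) * (f a - m) = 0" "t * (f b - m) = 0" by linarith+
    then show "a \<in> convex hull {x \<in> V. f x = m}" "b \<in> convex hull {x \<in> V. f x = m}"
      using eq a b t by auto
  qed auto
qed

definition weight :: "('a \<Rightarrow> real) \<Rightarrow> 'a set \<Rightarrow> ('a, real) poly_mapping \<Rightarrow> real" where
  "weight w E x = (\<Sum>e\<in>E. w e * Poly_Mapping.lookup x e)"

lemma lookup_scaleR: "Poly_Mapping.lookup (r *\<^sub>R x) e = r *\<^sub>R Poly_Mapping.lookup x e"
proof -
  have "finite {e. r *\<^sub>R Poly_Mapping.lookup x e \<noteq> 0}"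
    by (rule finite_subset[OF _ finite_lookup[of x]]) auto
  then show ?thesis by (simp add: scaleR_poly_mapping_def)
qed

lemma linear_weight: "linear (weight w E)"
  by (rule linearI) (simp_all add: weight_def lookup_add lookup_scaleR distrib_left sum.distrib sum_distrib_left mult.left_commute)

lemma lookup_incidence: "finite M \<Longrightarrow> Poly_Mapping.lookup (incidence_vec M) e = (if e \<in> M then 1 else 0)"
  by (simp add: incidence_vec_def lookup_sum lookup_single when_def)

lemma weight_incidence:
  assumes "finite E" "M \<subseteq> E"
  shows "weight w E (incidence_vec M) = sum w M"
proof -
  have "finite M" using assms finite_subset by blast
  then have "weight w E (incidence_vec M) = (\<Sum>e\<in>E. if e \<in> M then w e else 0)"
    unfolding weight_def by (intro sum.cong) (auto simp: lookup_incidence)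
  then show ?thesis using assms by (simp add: sum.If_cases Int_absorb1)
qed

lemma incidence_inj:
  assumes "finite M" "finite M'"
  shows "incidence_vec M = incidence_vec M' \<longleftrightarrow> M = M'"
proof
  assume "incidence_vec M = incidence_vec M'"
  then have "\<And>e. (e \<in> M) = (e \<in> M')" using assms lookup_incidence by (metis zero_neq_one)
  then show "M = M'" by auto
qed simp

text \<open>Rewarding the edges of \<open>I\<close> and punishing those outside \<open>U\<close>
  gives a functional whose least value \<open>- card I\<close> is attained exactly between
  \<open>I\<close> and \<open>U\<close>. Taking \<open>I = U = M\<close> yields vertices; taking the
  intersection and the union of two sets yields polytope edges.\<close>

lemma face_incidence:
  assumes fin: "finite E" and V: "V \<subseteq> Pow E" and I: "I \<subseteq> U" "U \<subseteq> E" and ne: "\<exists>M\<in>V. I \<subseteq> M \<and> M \<subseteq> U"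
  shows "convex hull (incidence_vec ` {M \<in> V. I \<subseteq> M \<and> M \<subseteq> U}) face_of convex hull (incidence_vec ` V)"
proof -
  let ?w = "\<lambda>e. if e \<in> I then - 1 else if e \<in> U then 0 else 1 :: real"
  have w: "weight ?w E (incidence_vec M) = real (card (M - U)) - real (card (M \<inter> I))" if "M \<in> V" for M
  proof -
    have M: "M \<subseteq> E" "finite M" using V that fin finite_subset by blast+
    have "sum ?w M = (\<Sum>e\<in>M. (if e \<in> - U then 1 else 0) - (if e \<in> I then 1 else 0))"
      using I by (intro sum.cong) auto
    also have "\<dots> = real (card (M - U)) - real (card (M \<inter> I))"
      using M(2) by (simp add: sum_subtractf sum.If_cases Diff_eq Compl_eq)
    finally show ?thesis using weight_incidence[OF fin M(1)] by simp
  qed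
  have finI: "finite I" using I fin by (meson finite_subset)
  have ge: "- real (card I) \<le> weight ?w E (incidence_vec M)"
    and eq: "weight ?w E (incidence_vec M) = - real (card I) \<longleftrightarrow> I \<subseteq> M \<and> M \<subseteq> U" if "M \<in> V" for M
  proof -
    have M: "finite M" using V that fin by (meson PowD finite_subset subsetD)
    have le: "card (M \<inter> I) \<le> card I" using finI by (intro card_mono) auto
    then show "- real (card I) \<le> weight ?w E (incidence_vec M)" using w[OF that] by simp
    have "card (M \<inter> I) = card I \<longleftrightarrow> I \<subseteq> M" using card_subset_eq[of I "M \<inter> I"] finI by (auto simp: Int_absorb1)
    moreover have "card (M - U) = 0 \<longleftrightarrow> M \<subseteq> U" using M by auto
    ultimately show "weight ?w E (incidence_vec M) = - real (card I) \<longleftrightarrow> I \<subseteq> M \<and> M \<subseteq> U"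
      using w[OF that] le by linarith
  qed
  have "finite V" using V fin by (metis finite_Pow_iff finite_subset)
  then have "convex hull {x \<in> incidence_vec ` V. weight ?w E x = - real (card I)} face_of convex hull (incidence_vec ` V)"
    using ge by (intro face_of_convex_hull_minimizers linear_weight) auto
  moreover have "{x \<in> incidence_vec ` V. weight ?w E x = - real (card I)} = incidence_vec ` {M \<in> V. I \<subseteq> M \<and> M \<subseteq> U}"
    using eq by auto
  ultimately show ?thesis by simp
qed

lemma vertices_of_hull_incidence:
  assumes fin: "finite E" and V: "V \<subseteq> Pow E"
  shows "vertices_of (convex hull (incidence_vec ` V)) = incidence_vec ` V"
proof
  show "vertices_of (convex hull (incidence_vec ` V)) \<subseteq> incidence_vec ` V"
    using extreme_point_of_convex_hull by (auto simp: vertices_of_def)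
  show "incidence_vec ` V \<subseteq> vertices_of (convex hull (incidence_vec ` V))"
  proof safe
    fix M assume M: "M \<in> V"
    then have "{N \<in> V. M \<subseteq> N \<and> N \<subseteq> M} = {M}" by auto
    then show "incidence_vec M \<in> vertices_of (convex hull (incidence_vec ` V))"
      using face_incidence[OF fin V, of M M] M V by (auto simp: vertices_of_def face_of_singleton)
  qed
qed

lemma edge_between_incidence:
  assumes fin: "finite E" and V: "V \<subseteq> Pow E" and M: "M \<in> V" "M' \<in> V" "M \<noteq> M'"
    and only: "\<And>N. N \<in> V \<Longrightarrow> M \<inter> M' \<subseteq> N \<Longrightarrow> N \<subseteq> M \<union> M' \<Longrightarrow> N = M \<or> N = M'"
  shows "edge_between (convex hull (incidence_vec ` V)) (incidence_vec M) (incidence_vec M')"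
proof -
  have eq: "{N \<in> V. M \<inter> M' \<subseteq> N \<and> N \<subseteq> M \<union> M'} = {M, M'}" using M only by auto
  have finM: "finite M" "finite M'" using M V fin finite_subset by blast+
  show ?thesis
  proof -
    have "\<exists>N\<in>V. M \<inter> M' \<subseteq> N \<and> N \<subseteq> M \<union> M'" using M(1) by blast
    then have "convex hull (incidence_vec ` {M, M'}) face_of convex hull (incidence_vec ` V)"
      using face_incidence[OF fin V, of "M \<inter> M'" "M \<union> M'"] M V eq by auto
    then show ?thesis
      using M(3) incidence_inj[OF finM] by (simp add: edge_between_def segment_convex_hull)
  qed
qed

text \<open>Integer costs may tie, but a nondegenerate objective must not. Each edge gets its own
  power of two as extra cost, scaled so that all of them together stay below 1: different sets then
  have different binary expansions, while strict comparisons of integer costs survive.\<close>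

lemma monotone_path_incidence:
  fixes c :: "nat set \<Rightarrow> int" and Ms :: "nat set set list"
  assumes fin: "finite E" and V: "V \<subseteq> Pow E" and Ms: "Ms \<noteq> []" "set Ms \<subseteq> V"
    and steps: "successively (\<lambda>M M'. (\<forall>N\<in>V. M \<inter> M' \<subseteq> N \<longrightarrow> N \<subseteq> M \<union> M' \<longrightarrow> N = M \<or> N = M') \<and> sum c M' < sum c M) Ms"
    and opt: "\<And>M. M \<in> V \<Longrightarrow> M \<noteq> last Ms \<Longrightarrow> sum c (last Ms) < sum c M"
  shows "monotone_path (convex hull (incidence_vec ` V)) (map incidence_vec Ms)"
proof -
  let ?Q = "convex hull (incidence_vec ` V)"
  obtain r :: "nat set \<Rightarrow> nat" and K where r: "r ` E = {i. i < K}" "inj_on r E"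
    using finite_imp_inj_to_nat_seg[OF fin] by blast
  define w :: "nat set \<Rightarrow> real" where "w e = of_int (c e) + 2 ^ r e / 2 ^ K" for e
  have w: "weight w E (incidence_vec M) = of_int (sum c M) + real (set_encode (r ` M)) / 2 ^ K" if "M \<in> V" for M
  proof -
    have "M \<subseteq> E" using V that by blast
    then have "set_encode (r ` M) = (\<Sum>e\<in>M. 2 ^ r e)"
      using r(2) by (simp add: set_encode_def sum.reindex inj_on_subset)
    then show ?thesis using weight_incidence[OF fin \<open>M \<subseteq> E\<close>] by (simp add: w_def sum.distrib sum_divide_distrib)
  qed
  have frac: "real (set_encode (r ` M)) / 2 ^ K < 1" if "M \<in> V" for M
  proof -
    have "r ` M \<subseteq> {..<K}" using V that r(1) by auto
    then have "set_encode (r ` M) \<le> (\<Sum>i<K. 2 ^ i)" unfolding set_encode_def by (intro sum_mono2) auto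
    also have "\<dots> < 2 ^ K" by (induction K) auto
    finally have "real (set_encode (r ` M)) < real (2 ^ K)" by (simp only: of_nat_less_iff)
    then show ?thesis by simp
  qed
  have less: "weight w E (incidence_vec M) < weight w E (incidence_vec M')" if "M \<in> V" "M' \<in> V" "sum c M < sum c M'" for M M'
  proof -
    have "of_int (sum c M) + 1 \<le> (of_int (sum c M') :: real)" using that(3) by (metis of_int_1 of_int_add of_int_le_iff zless_imp_add1_zle)
    moreover have "0 \<le> real (set_encode (r ` M')) / 2 ^ K" by simp
    ultimately show ?thesis using w[OF that(1)] w[OF that(2)] frac[OF that(1)] by linarith
  qed
  have inj: "M = M'" if M: "M \<in> V" "M' \<in> V" "weight w E (incidence_vec M) = weight w E (incidence_vec M')" for M M'
  proof -
    have "sum c M = sum c M'" using less[OF M(1,2)] less[OF M(2,1)] M(3) by linarith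
    then have "set_encode (r ` M) = set_encode (r ` M')" using w[OF M(1)] w[OF M(2)] M(3) by simp
    moreover have "finite (r ` M)" "finite (r ` M')"
      using M(1,2) V fin by (meson PowD finite_imageI finite_subset subsetD)+
    ultimately have "r ` M = r ` M'" by (simp only: set_encode_eq)
    moreover have "M \<subseteq> E" "M' \<subseteq> E" using M(1,2) V by auto
    ultimately show "M = M'" using inj_on_image_eq_iff[OF r(2)] by blast
  qed
  note vert = vertices_of_hull_incidence[OF fin V]
  have last: "last Ms \<in> V" using Ms by auto
  have "nondegenerate_objective ?Q (weight w E)"
    unfolding nondegenerate_objective_def vert using linear_weight inj by (auto simp: inj_on_def)
  moreover have "successively (oriented_edge ?Q (weight w E)) (map incidence_vec Ms)"
    unfolding successively_map
  proof (rule successively_mono[OF steps])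
    fix M M' assume "M \<in> set Ms" "M' \<in> set Ms"
      and *: "(\<forall>N\<in>V. M \<inter> M' \<subseteq> N \<longrightarrow> N \<subseteq> M \<union> M' \<longrightarrow> N = M \<or> N = M') \<and> sum c M' < sum c M"
    then have M: "M \<in> V" "M' \<in> V" "M \<noteq> M'" using Ms by auto
    show "oriented_edge ?Q (weight w E) (incidence_vec M) (incidence_vec M')"
      unfolding oriented_edge_def using edge_between_incidence[OF fin V M] less[OF M(2,1)] * by blast
  qed
  moreover have "optimal_vertex ?Q (weight w E) (last (map incidence_vec Ms))"
    unfolding optimal_vertex_def vert using last less[OF last] opt Ms(1) by (force simp: last_map)
  ultimately show ?thesis
    unfolding monotone_path_def monotone_path_for_def vert
    using Ms by (intro exI[of _ "weight w E"]) auto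
qed

section \<open>Successors in cyclic lists\<close>

text \<open>The successor in the cyclic order of \<open>xs\<close>: the head of the rotation that
  starts behind \<open>a\<close>. The final \<open>[a]\<close> makes the element of a one-element
  list its own successor.\<close>

definition nxt :: "'a list \<Rightarrow> 'a \<Rightarrow> 'a" where
  "nxt xs a = hd (tl (dropWhile (\<lambda>z. z \<noteq> a) xs) @ takeWhile (\<lambda>z. z \<noteq> a) xs @ [a])"

lemma nxt_split:
  assumes "a \<notin> set P"
  shows "nxt (P @ a # Q) a = hd (Q @ P @ [a])"
proof -
  have "dropWhile (\<lambda>z. z \<noteq> a) (P @ a # Q) = a # Q" "takeWhile (\<lambda>z. z \<noteq> a) (P @ a # Q) = P"
    using assms by (auto simp: dropWhile_append takeWhile_append)
  then show ?thesis by (simp add: nxt_def)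
qed

lemma nxt_rotate:
  assumes "distinct (P @ Q)" "a \<in> set (P @ Q)"
  shows "nxt (Q @ P) a = nxt (P @ Q) a"
proof (cases "a \<in> set P")
  case True
  then obtain P1 P2 where P: "P = P1 @ a # P2" by (meson split_list)
  then have "a \<notin> set P1" "a \<notin> set Q" using assms(1) by auto
  then show ?thesis using nxt_split[of a P1 "P2 @ Q"] nxt_split[of a "Q @ P1" P2] by (simp add: P)
next
  case False
  then have "a \<in> set Q" using assms(2) by simp
  then obtain Q1 Q2 where Q: "Q = Q1 @ a # Q2" by (meson split_list)
  then have "a \<notin> set Q1" using assms(1) by auto
  then show ?thesis using False nxt_split[of a "P @ Q1" Q2] nxt_split[of a Q1 "Q2 @ P"] by (simp add: Q)
qed

lemma nxt_nth:
  assumes "distinct xs" "i < length xs"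
  shows "nxt xs (xs ! i) = xs ! (Suc i mod length xs)"
proof -
  have eq: "xs = take i xs @ xs ! i # drop (Suc i) xs" using assms(2) by (simp add: id_take_nth_drop)
  have "xs ! i \<notin> set (take i xs)"
    using assms by (auto simp: in_set_conv_nth nth_eq_iff_index_eq)
  then have "nxt xs (xs ! i) = hd (drop (Suc i) xs @ take i xs @ [xs ! i])"
    using nxt_split[of "xs ! i" "take i xs" "drop (Suc i) xs"] eq by simp
  also have "\<dots> = xs ! (Suc i mod length xs)"
  proof (cases "Suc i < length xs")
    case True
    then show ?thesis by (simp add: hd_drop_conv_nth)
  next
    case False
    then have "Suc i = length xs" using assms(2) by simp
    then show ?thesis using assms by (cases i; cases xs) (auto simp: hd_append)
  qed
  finally show ?thesis .
qed

lemma nxt_in_set: "distinct xs \<Longrightarrow> a \<in> set xs \<Longrightarrow> nxt xs a \<in> set xs"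
  by (auto simp: in_set_conv_nth[of a] nxt_nth intro!: nth_mem mod_less_divisor)

lemma inj_on_nxt:
  assumes "distinct xs"
  shows "inj_on (nxt xs) (set xs)"
proof (rule inj_onI)
  fix a b assume ab: "a \<in> set xs" "b \<in> set xs" "nxt xs a = nxt xs b"
  then obtain i j where ij: "i < length xs" "j < length xs" "a = xs ! i" "b = xs ! j"
    by (auto simp: in_set_conv_nth)
  then have "Suc i mod length xs = Suc j mod length xs"
    using ab assms nth_eq_iff_index_eq[OF assms, of "Suc i mod length xs" "Suc j mod length xs"]
    by (metis length_pos_if_in_set mod_less_divisor nxt_nth)
  then have "i = j" using ij(1,2) by (auto simp: mod_Suc split: if_splits)
  then show "a = b" using ij by simp
qed

lemma nxt_image:
  assumes "distinct xs" shows "nxt xs ` set xs = set xs"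
  using assms inj_on_nxt[OF assms] nxt_in_set[OF assms]
  by (intro endo_inj_surj) auto

lemma nxt_neq: 
  assumes "distinct xs" "2 \<le> length xs" "a \<in> set xs" shows "nxt xs a \<noteq> a"
proof -
  obtain i where i: "i < length xs" "a = xs ! i" using assms by (auto simp: in_set_conv_nth)
  moreover have "Suc i mod length xs < length xs" "Suc i mod length xs \<noteq> i"
    using assms i by (auto simp: mod_Suc intro: mod_less_divisor)
  ultimately show ?thesis using assms by (simp add: nxt_nth nth_eq_iff_index_eq)
qed

lemma nxt_nxt_neq: 
  assumes "distinct xs" "3 \<le> length xs" "a \<in> set xs" shows "nxt xs (nxt xs a) \<noteq> a"
proof -
  obtain i where i: "i < length xs" "a = xs ! i" using assms by (auto simp: in_set_conv_nth)
  moreover have "Suc i mod length xs < length xs" "Suc (Suc i mod length xs) mod length xs < length xs"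
    "Suc (Suc i mod length xs) mod length xs \<noteq> i"
    using assms i by (auto simp: mod_Suc intro: mod_less_divisor)
  ultimately show ?thesis using assms by (simp add: nxt_nth nth_eq_iff_index_eq)
qed

text \<open>Iterating the successor from any element visits every position modulo the length. This
  is the tool that excludes short cycles.\<close>

lemma nxt_closed_imp_all:
  assumes "distinct xs" "X \<subseteq> set xs" "X \<noteq> {}" "\<And>a. a \<in> X \<Longrightarrow> nxt xs a \<in> X"
  shows "X = set xs"
proof -
  obtain a where a: "a \<in> X" "a \<in> set xs" using assms by auto
  then obtain i where i: "i < length xs" "a = xs ! i" by (auto simp: in_set_conv_nth)
  have *: "xs ! ((i + k) mod length xs) \<in> X" for k
  proof (induction k)
    case 0 then show ?case using a i by simp
  next
    case (Suc k)
    have "(i + k) mod length xs < length xs" using i by (intro mod_less_divisor) auto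
    then show ?case using assms(4)[OF Suc] assms(1) by (simp add: nxt_nth mod_Suc_eq)
  qed
  have "xs ! j \<in> X" if "j < length xs" for j
    using *[of "j + length xs - i"] i that by simp
  then show ?thesis using assms(2) by (auto simp: in_set_conv_nth)
qed

section \<open>Cyclic lists cut into segments and reassembled\<close>

lemma nxt_concat:
  assumes "distinct (concat Ss)" "[] \<notin> set Ss" "S \<in> set Ss" "a \<in> set S"
  shows "nxt (concat Ss) a = (if a = last S then hd (nxt Ss S) else nxt S a)"
proof -
  obtain P Q where Ss: "Ss = P @ S # Q" "S \<notin> set P" using assms(3) by (meson split_list_first)
  obtain S1 S2 where S: "S = S1 @ a # S2" using assms(4) by (meson split_list)
  have a: "a \<notin> set (concat P)" "a \<notin> set S1" "a \<notin> set S2" using assms(1) Ss S by auto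
  have c: "nxt (concat Ss) a = hd ((S2 @ concat Q) @ (concat P @ S1) @ [a])"
    using a nxt_split[of a "concat P @ S1" "S2 @ concat Q"] by (simp add: Ss S)
  have n: "nxt Ss S = hd (Q @ P @ [S])" using nxt_split[OF Ss(2)] Ss by simp
  show ?thesis
  proof (cases S2)
    case Nil
    have hc: "hd (concat L @ M) = hd (hd L)" if "L \<noteq> []" "hd L \<noteq> []" for L :: "'a list list" and M
      using that by (cases L) auto
    have ne: "R \<noteq> []" if "R \<in> set Q \<union> set P \<union> {S}" for R using that assms(2) Ss by auto
    then have "hd (Q @ P @ [S]) \<noteq> []" by (cases Q; cases P) auto
    then have "hd (concat (Q @ P @ [S]) @ []) = hd (hd (Q @ P @ [S]))" by (intro hc) auto
    then show ?thesis using c n S Nil by (simp add: hd_append)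
  next
    case (Cons b S3)
    then have "a \<noteq> last S" using a S by auto
    moreover have "nxt S a = b" using nxt_split[OF a(2), of S2] S Cons by simp
    ultimately show ?thesis using c Cons by simp
  qed
qed

text \<open>The elements whose successor changes form a single orbit of \<open>a \<mapsto> (nxt xs)\<^sup>-\<^sup>1 (nxt zs a)\<close>.\<close>

definition adj :: "'a list \<Rightarrow> 'a list \<Rightarrow> bool" where
  "adj xs zs \<longleftrightarrow> (\<forall>P. (\<forall>a\<in>set xs. \<forall>b\<in>set xs. nxt zs a \<noteq> nxt xs a \<longrightarrow> nxt zs a = nxt xs b \<longrightarrow> P a = P b) \<longrightarrow>
     (\<forall>a\<in>set xs. \<forall>b\<in>set xs. nxt zs a \<noteq> nxt xs a \<longrightarrow> nxt zs b \<noteq> nxt xs b \<longrightarrow> P a = (P b :: bool)))"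

lemma adj_cong:
  assumes "adj xs zs" "set xs' = set xs" "\<And>a. a \<in> set xs \<Longrightarrow> nxt xs' a = nxt xs a" "\<And>a. a \<in> set xs \<Longrightarrow> nxt zs' a = nxt zs a"
  shows "adj xs' zs'"
  using assms(1) unfolding adj_def assms(2) by (simp add: assms(3,4) cong: ball_cong)

lemma hd_concat_eq_iff:
  assumes "distinct (concat Ss)" "[] \<notin> set Ss" "S \<in> set Ss" "T \<in> set Ss" "set S \<inter> set T \<noteq> {}"
  shows "S = T"
  using assms by (metis distinct_concat_iff disjoint_iff inf_commute)

lemma distinct_segments:
  assumes "distinct (concat Ss)" "[] \<notin> set Ss"
  shows "distinct Ss"
proof -
  have "[] \<notin> set Ss" using assms(2) .
  then show ?thesis using assms(1) by (simp add: distinct_concat_iff)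
qed

context
  fixes Ss Ts :: "'a list list"
  assumes dSs: "distinct (concat Ss)" and ne: "[] \<notin> set Ss"
    and dTs: "distinct Ts" and set_eq: "set Ts = set Ss"
begin

lemma distinct_rearranged: "distinct (concat Ts)"
proof (rule distinct_concat)
  fix S assume "S \<in> set Ts"
  then show "distinct S" using dSs set_eq by (metis distinct_concat_iff)
next
  fix S T assume "S \<in> set Ts" "T \<in> set Ts" "S \<noteq> T"
  then show "set S \<inter> set T = {}" using hd_concat_eq_iff[OF dSs ne] set_eq by blast
qed (use dTs in simp)

lemma set_rearranged: "set (concat Ts) = set (concat Ss)"
  using set_eq by simp

lemma nxt_segments_eq_iff:
  assumes "S \<in> set Ss" "T \<in> set Ss"
  shows "hd (nxt Ts S) = hd (nxt Ss T) \<longleftrightarrow> nxt Ts S = nxt Ss T"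
proof
  have in1: "nxt Ts S \<in> set Ss" using nxt_in_set[OF dTs, of S] assms set_eq by simp
  have in2: "nxt Ss T \<in> set Ss" using nxt_in_set[OF distinct_segments[OF dSs ne], of T] assms by simp
  assume "hd (nxt Ts S) = hd (nxt Ss T)"
  then have "set (nxt Ts S) \<inter> set (nxt Ss T) \<noteq> {}"
    using in1 in2 ne by (metis disjoint_iff hd_in_set)
  then show "nxt Ts S = nxt Ss T" using hd_concat_eq_iff[OF dSs ne in1 in2] by blast
qed simp

lemma nxt_rearranged:
  assumes "S \<in> set Ss" "a \<in> set S"
  shows "nxt (concat Ts) a = (if a = last S then hd (nxt Ts S) else nxt S a)"
  using nxt_concat[OF distinct_rearranged, of S a] assms set_eq ne by simp

text \<open>Only last elements of segments change their successors, and they do so exactly as the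
  segments do. A predicate on elements pulls back along \<open>last\<close> to one on segments, so a
  single orbit of segments gives a single orbit of elements.\<close>

lemma adj_concat:
  assumes "adj Ss Ts"
  shows "adj (concat Ss) (concat Ts)"
  unfolding adj_def
proof (intro allI impI ballI)
  fix P :: "'a \<Rightarrow> bool" and a b
  assume P: "\<forall>a\<in>set (concat Ss). \<forall>b\<in>set (concat Ss). nxt (concat Ts) a \<noteq> nxt (concat Ss) a \<longrightarrow>
        nxt (concat Ts) a = nxt (concat Ss) b \<longrightarrow> P a = P b"
    and ab: "a \<in> set (concat Ss)" "b \<in> set (concat Ss)"
    "nxt (concat Ts) a \<noteq> nxt (concat Ss) a" "nxt (concat Ts) b \<noteq> nxt (concat Ss) b"
  have last: "nxt (concat Ss) (last S) = hd (nxt Ss S)" "nxt (concat Ts) (last S) = hd (nxt Ts S)" "last S \<in> set (concat Ss)"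
    if "S \<in> set Ss" for S
    using that nxt_concat[OF dSs ne that, of "last S"] nxt_rearranged[OF that, of "last S"] ne
    by (auto intro!: bexI[of _ S]) (metis last_in_set)+
  have ends: "\<exists>S\<in>set Ss. a = last S \<and> nxt Ts S \<noteq> nxt Ss S"
    if a: "a \<in> set (concat Ss)" and neq: "nxt (concat Ts) a \<noteq> nxt (concat Ss) a" for a
  proof -
    obtain S where S: "S \<in> set Ss" "a \<in> set S" using a by auto
    then have "a = last S" using neq nxt_concat[OF dSs ne S] nxt_rearranged[OF S] by metis
    then show ?thesis using S neq last[OF S(1)] by metis
  qed
  obtain S T where S: "S \<in> set Ss" "a = last S" "nxt Ts S \<noteq> nxt Ss S"
    and T: "T \<in> set Ss" "b = last T" "nxt Ts T \<noteq> nxt Ss T"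
    using ends ab by meson
  have "P (last A) = P (last B)" if "A \<in> set Ss" "B \<in> set Ss" "nxt Ts A \<noteq> nxt Ss A" "nxt Ts A = nxt Ss B" for A B
    using P that last[OF that(1)] last[OF that(2)] nxt_segments_eq_iff by metis
  then have "P (last S) = P (last T)"
    using assms[unfolded adj_def, rule_format, of "\<lambda>S. P (last S)" S T] S T by blast
  then show "P a = P b" using S T by simp
qed

end


text \<open>\<open>A\<close> is the set of elements whose successor may change.\<close>

definition move :: "'a set \<Rightarrow> 'a list \<Rightarrow> 'a list \<Rightarrow> bool" where
  "move A xs zs \<longleftrightarrow> distinct zs \<and> set zs = set xs \<and> adj xs zs \<and> (\<forall>a\<in>set xs - A. nxt zs a = nxt xs a)"

text \<open>Reduces an exchange on an arbitrary cyclic list to a finite check on a short list of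
  distinct symbols, the segments.\<close>

lemma move_concat:
  assumes dSs: "distinct (concat Ss)" and ne: "[] \<notin> set Ss" and lastA: "\<forall>S\<in>set Ss. last S \<in> A"
    and Ts: "distinct Ss \<Longrightarrow> set Ts = set Ss \<and> distinct Ts \<and> adj Ss Ts"
  shows "move A (concat Ss) (concat Ts)"
    and "S \<in> set Ss \<Longrightarrow> nxt (concat Ts) (last S) = hd (nxt Ts S)"
    and "distinct Ss"
proof -
  show dS: "distinct Ss" by (rule distinct_segments[OF dSs ne])
  have T: "set Ts = set Ss" "distinct Ts" "adj Ss Ts" using Ts[OF dS] by auto
  note nR = nxt_rearranged[OF dSs ne T(2,1)]
  have "nxt (concat Ts) a = nxt (concat Ss) a" if "a \<in> set (concat Ss)" "a \<notin> A" for a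
  proof -
    obtain S where S: "S \<in> set Ss" "a \<in> set S" using \<open>a \<in> set (concat Ss)\<close> by auto
    then show ?thesis using nxt_concat[OF dSs ne S] nR[OF S] \<open>a \<notin> A\<close> lastA by auto
  qed
  then show "move A (concat Ss) (concat Ts)"
    using distinct_rearranged[OF dSs ne T(2,1)] set_rearranged[OF dSs ne T(2,1)]
      adj_concat[OF dSs ne T(2,1,3)] by (auto simp: move_def)
  show "S \<in> set Ss \<Longrightarrow> nxt (concat Ts) (last S) = hd (nxt Ts S)"
    using nR[of S "last S"] ne by (metis last_in_set)
qed

text \<open>Here \<open>cs\<close> lists the orbit in cyclic order.\<close>

lemma adjI:
  assumes "set cs = set xs"
    and "successively (\<lambda>a b. nxt zs a \<noteq> nxt xs a \<and> nxt zs a = nxt xs b) cs"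
  shows "adj xs zs"
  unfolding adj_def
proof (intro allI impI ballI)
  fix P :: "'a \<Rightarrow> bool" and a b
  assume P: "\<forall>a\<in>set xs. \<forall>b\<in>set xs. nxt zs a \<noteq> nxt xs a \<longrightarrow> nxt zs a = nxt xs b \<longrightarrow> P a = P b"
    and ab: "a \<in> set xs" "b \<in> set xs"
  have "successively (\<lambda>a b. P a = P b) cs"
    by (rule successively_mono[OF assms(2)]) (use P assms(1) in auto)
  then have "P a = P (hd cs)" if "a \<in> set cs" for a
    using that by (induction cs rule: induct_list012) auto
  then show "P a = P b" using ab assms(1) by metis
qed

text \<open>The suffix of each name is the order in which the segments are reassembled.\<close>

lemma move_132:
  assumes "distinct (S1 @ S2 @ S3)" "[] \<notin> {S1, S2, S3}" "last ` {S1, S2, S3} \<subseteq> A"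
  shows "\<exists>zs. move A (S1 @ S2 @ S3) zs \<and>
    nxt zs (last S1) = hd S3 \<and> nxt zs (last S2) = hd S1 \<and> nxt zs (last S3) = hd S2"
proof -
  have N: "nxt [S1, S2, S3] S1 = S2 \<and> nxt [S1, S2, S3] S2 = S3 \<and> nxt [S1, S2, S3] S3 = S1"
    "nxt [S1, S3, S2] S1 = S3 \<and> nxt [S1, S3, S2] S2 = S1 \<and> nxt [S1, S3, S2] S3 = S2"
    if "distinct [S1, S2, S3]"
    using that by (auto simp: nxt_def)
  have T: "set [S1, S3, S2] = set [S1, S2, S3] \<and> distinct [S1, S3, S2] \<and> adj [S1, S2, S3] [S1, S3, S2]" if d: "distinct [S1, S2, S3]"
  proof (intro conjI)
    \<comment> \<open>The orbit is traced by asking who owned the new successor before: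
      \<open>S1\<close> now leads to \<open>S3\<close>, formerly the successor of \<open>S2\<close>,
      so \<open>S2\<close> comes next. The lists given to \<open>adjI\<close> in the following
      lemmas arise in the same way.\<close>
    show "adj [S1, S2, S3] [S1, S3, S2]"
      by (rule adjI[of "[S1, S2, S3]"]) (use N[OF d] d in auto)
  qed (use d in auto)
  have "distinct (concat [S1, S2, S3])" "[] \<notin> set [S1, S2, S3]" "\<forall>S\<in>set [S1, S2, S3]. last S \<in> A"
    using assms by auto
  note M = move_concat[OF this T]
  have "nxt (S1 @ S3 @ S2) (last S1) = hd S3 \<and> nxt (S1 @ S3 @ S2) (last S2) = hd S1 \<and> nxt (S1 @ S3 @ S2) (last S3) = hd S2"
    using M(2) N(2)[OF M(3)] by simp
  moreover have "move A (S1 @ S2 @ S3) (S1 @ S3 @ S2)"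
    using M(1) by simp
  ultimately show ?thesis by blast
qed

lemma move_13542:
  assumes "distinct (S1 @ S2 @ S3 @ S4 @ S5)" "[] \<notin> {S1, S2, S3, S4, S5}" "last ` {S1, S2, S3, S4, S5} \<subseteq> A"
  shows "\<exists>zs. move A (S1 @ S2 @ S3 @ S4 @ S5) zs \<and>
    nxt zs (last S1) = hd S3 \<and> nxt zs (last S2) = hd S1 \<and> nxt zs (last S3) = hd S5 \<and> nxt zs (last S4) = hd S2 \<and> nxt zs (last S5) = hd S4"
proof -
  have N: "nxt [S1, S2, S3, S4, S5] S1 = S2 \<and> nxt [S1, S2, S3, S4, S5] S2 = S3 \<and> nxt [S1, S2, S3, S4, S5] S3 = S4 \<and> nxt [S1, S2, S3, S4, S5] S4 = S5 \<and> nxt [S1, S2, S3, S4, S5] S5 = S1"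
    "nxt [S1, S3, S5, S4, S2] S1 = S3 \<and> nxt [S1, S3, S5, S4, S2] S2 = S1 \<and> nxt [S1, S3, S5, S4, S2] S3 = S5 \<and> nxt [S1, S3, S5, S4, S2] S4 = S2 \<and> nxt [S1, S3, S5, S4, S2] S5 = S4"
    if "distinct [S1, S2, S3, S4, S5]"
    using that by (auto simp: nxt_def)
  have T: "set [S1, S3, S5, S4, S2] = set [S1, S2, S3, S4, S5] \<and> distinct [S1, S3, S5, S4, S2] \<and> adj [S1, S2, S3, S4, S5] [S1, S3, S5, S4, S2]" if d: "distinct [S1, S2, S3, S4, S5]"
  proof (intro conjI)
    show "adj [S1, S2, S3, S4, S5] [S1, S3, S5, S4, S2]"
      by (rule adjI[of "[S1, S2, S5, S3, S4]"]) (use N[OF d] d in auto)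
  qed (use d in auto)
  have "distinct (concat [S1, S2, S3, S4, S5])" "[] \<notin> set [S1, S2, S3, S4, S5]" "\<forall>S\<in>set [S1, S2, S3, S4, S5]. last S \<in> A"
    using assms by auto
  note M = move_concat[OF this T]
  have "nxt (S1 @ S3 @ S5 @ S4 @ S2) (last S1) = hd S3 \<and> nxt (S1 @ S3 @ S5 @ S4 @ S2) (last S2) = hd S1 \<and> nxt (S1 @ S3 @ S5 @ S4 @ S2) (last S3) = hd S5 \<and> nxt (S1 @ S3 @ S5 @ S4 @ S2) (last S4) = hd S2 \<and> nxt (S1 @ S3 @ S5 @ S4 @ S2) (last S5) = hd S4"
    using M(2) N(2)[OF M(3)] by simp
  moreover have "move A (S1 @ S2 @ S3 @ S4 @ S5) (S1 @ S3 @ S5 @ S4 @ S2)"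
    using M(1) by simp
  ultimately show ?thesis by blast
qed

lemma move_15243:
  assumes "distinct (S1 @ S2 @ S3 @ S4 @ S5)" "[] \<notin> {S1, S2, S3, S4, S5}" "last ` {S1, S2, S3, S4, S5} \<subseteq> A"
  shows "\<exists>zs. move A (S1 @ S2 @ S3 @ S4 @ S5) zs \<and>
    nxt zs (last S1) = hd S5 \<and> nxt zs (last S2) = hd S4 \<and> nxt zs (last S3) = hd S1 \<and> nxt zs (last S4) = hd S3 \<and> nxt zs (last S5) = hd S2"
proof -
  have N: "nxt [S1, S2, S3, S4, S5] S1 = S2 \<and> nxt [S1, S2, S3, S4, S5] S2 = S3 \<and> nxt [S1, S2, S3, S4, S5] S3 = S4 \<and> nxt [S1, S2, S3, S4, S5] S4 = S5 \<and> nxt [S1, S2, S3, S4, S5] S5 = S1"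
    "nxt [S1, S5, S2, S4, S3] S1 = S5 \<and> nxt [S1, S5, S2, S4, S3] S2 = S4 \<and> nxt [S1, S5, S2, S4, S3] S3 = S1 \<and> nxt [S1, S5, S2, S4, S3] S4 = S3 \<and> nxt [S1, S5, S2, S4, S3] S5 = S2"
    if "distinct [S1, S2, S3, S4, S5]"
    using that by (auto simp: nxt_def)
  have T: "set [S1, S5, S2, S4, S3] = set [S1, S2, S3, S4, S5] \<and> distinct [S1, S5, S2, S4, S3] \<and> adj [S1, S2, S3, S4, S5] [S1, S5, S2, S4, S3]" if d: "distinct [S1, S2, S3, S4, S5]"
  proof (intro conjI)
    show "adj [S1, S2, S3, S4, S5] [S1, S5, S2, S4, S3]"
      by (rule adjI[of "[S1, S4, S2, S3, S5]"]) (use N[OF d] d in auto)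
  qed (use d in auto)
  have "distinct (concat [S1, S2, S3, S4, S5])" "[] \<notin> set [S1, S2, S3, S4, S5]" "\<forall>S\<in>set [S1, S2, S3, S4, S5]. last S \<in> A"
    using assms by auto
  note M = move_concat[OF this T]
  have "nxt (S1 @ S5 @ S2 @ S4 @ S3) (last S1) = hd S5 \<and> nxt (S1 @ S5 @ S2 @ S4 @ S3) (last S2) = hd S4 \<and> nxt (S1 @ S5 @ S2 @ S4 @ S3) (last S3) = hd S1 \<and> nxt (S1 @ S5 @ S2 @ S4 @ S3) (last S4) = hd S3 \<and> nxt (S1 @ S5 @ S2 @ S4 @ S3) (last S5) = hd S2"
    using M(2) N(2)[OF M(3)] by simp
  moreover have "move A (S1 @ S2 @ S3 @ S4 @ S5) (S1 @ S5 @ S2 @ S4 @ S3)"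
    using M(1) by simp
  ultimately show ?thesis by blast
qed

lemma move_13254:
  assumes "distinct (S1 @ S2 @ S3 @ S4 @ S5)" "[] \<notin> {S1, S2, S3, S4, S5}" "last ` {S1, S2, S3, S4, S5} \<subseteq> A"
  shows "\<exists>zs. move A (S1 @ S2 @ S3 @ S4 @ S5) zs \<and>
    nxt zs (last S1) = hd S3 \<and> nxt zs (last S2) = hd S5 \<and> nxt zs (last S3) = hd S2 \<and> nxt zs (last S4) = hd S1 \<and> nxt zs (last S5) = hd S4"
proof -
  have N: "nxt [S1, S2, S3, S4, S5] S1 = S2 \<and> nxt [S1, S2, S3, S4, S5] S2 = S3 \<and> nxt [S1, S2, S3, S4, S5] S3 = S4 \<and> nxt [S1, S2, S3, S4, S5] S4 = S5 \<and> nxt [S1, S2, S3, S4, S5] S5 = S1"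
    "nxt [S1, S3, S2, S5, S4] S1 = S3 \<and> nxt [S1, S3, S2, S5, S4] S2 = S5 \<and> nxt [S1, S3, S2, S5, S4] S3 = S2 \<and> nxt [S1, S3, S2, S5, S4] S4 = S1 \<and> nxt [S1, S3, S2, S5, S4] S5 = S4"
    if "distinct [S1, S2, S3, S4, S5]"
    using that by (auto simp: nxt_def)
  have T: "set [S1, S3, S2, S5, S4] = set [S1, S2, S3, S4, S5] \<and> distinct [S1, S3, S2, S5, S4] \<and> adj [S1, S2, S3, S4, S5] [S1, S3, S2, S5, S4]" if d: "distinct [S1, S2, S3, S4, S5]"
  proof (intro conjI)
    show "adj [S1, S2, S3, S4, S5] [S1, S3, S2, S5, S4]"
      by (rule adjI[of "[S1, S2, S4, S5, S3]"]) (use N[OF d] d in auto)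
  qed (use d in auto)
  have "distinct (concat [S1, S2, S3, S4, S5])" "[] \<notin> set [S1, S2, S3, S4, S5]" "\<forall>S\<in>set [S1, S2, S3, S4, S5]. last S \<in> A"
    using assms by auto
  note M = move_concat[OF this T]
  have "nxt (S1 @ S3 @ S2 @ S5 @ S4) (last S1) = hd S3 \<and> nxt (S1 @ S3 @ S2 @ S5 @ S4) (last S2) = hd S5 \<and> nxt (S1 @ S3 @ S2 @ S5 @ S4) (last S3) = hd S2 \<and> nxt (S1 @ S3 @ S2 @ S5 @ S4) (last S4) = hd S1 \<and> nxt (S1 @ S3 @ S2 @ S5 @ S4) (last S5) = hd S4"
    using M(2) N(2)[OF M(3)] by simp
  moreover have "move A (S1 @ S2 @ S3 @ S4 @ S5) (S1 @ S3 @ S2 @ S5 @ S4)"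
    using M(1) by simp
  ultimately show ?thesis by blast
qed

lemma move_14253:
  assumes "distinct (S1 @ S2 @ S3 @ S4 @ S5)" "[] \<notin> {S1, S2, S3, S4, S5}" "last ` {S1, S2, S3, S4, S5} \<subseteq> A"
  shows "\<exists>zs. move A (S1 @ S2 @ S3 @ S4 @ S5) zs \<and>
    nxt zs (last S1) = hd S4 \<and> nxt zs (last S2) = hd S5 \<and> nxt zs (last S3) = hd S1 \<and> nxt zs (last S4) = hd S2 \<and> nxt zs (last S5) = hd S3"
proof -
  have N: "nxt [S1, S2, S3, S4, S5] S1 = S2 \<and> nxt [S1, S2, S3, S4, S5] S2 = S3 \<and> nxt [S1, S2, S3, S4, S5] S3 = S4 \<and> nxt [S1, S2, S3, S4, S5] S4 = S5 \<and> nxt [S1, S2, S3, S4, S5] S5 = S1"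
    "nxt [S1, S4, S2, S5, S3] S1 = S4 \<and> nxt [S1, S4, S2, S5, S3] S2 = S5 \<and> nxt [S1, S4, S2, S5, S3] S3 = S1 \<and> nxt [S1, S4, S2, S5, S3] S4 = S2 \<and> nxt [S1, S4, S2, S5, S3] S5 = S3"
    if "distinct [S1, S2, S3, S4, S5]"
    using that by (auto simp: nxt_def)
  have T: "set [S1, S4, S2, S5, S3] = set [S1, S2, S3, S4, S5] \<and> distinct [S1, S4, S2, S5, S3] \<and> adj [S1, S2, S3, S4, S5] [S1, S4, S2, S5, S3]" if d: "distinct [S1, S2, S3, S4, S5]"
  proof (intro conjI)
    show "adj [S1, S2, S3, S4, S5] [S1, S4, S2, S5, S3]"
      by (rule adjI[of "[S1, S3, S5, S2, S4]"]) (use N[OF d] d in auto)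
  qed (use d in auto)
  have "distinct (concat [S1, S2, S3, S4, S5])" "[] \<notin> set [S1, S2, S3, S4, S5]" "\<forall>S\<in>set [S1, S2, S3, S4, S5]. last S \<in> A"
    using assms by auto
  note M = move_concat[OF this T]
  have "nxt (S1 @ S4 @ S2 @ S5 @ S3) (last S1) = hd S4 \<and> nxt (S1 @ S4 @ S2 @ S5 @ S3) (last S2) = hd S5 \<and> nxt (S1 @ S4 @ S2 @ S5 @ S3) (last S3) = hd S1 \<and> nxt (S1 @ S4 @ S2 @ S5 @ S3) (last S4) = hd S2 \<and> nxt (S1 @ S4 @ S2 @ S5 @ S3) (last S5) = hd S3"
    using M(2) N(2)[OF M(3)] by simp
  moreover have "move A (S1 @ S2 @ S3 @ S4 @ S5) (S1 @ S4 @ S2 @ S5 @ S3)"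
    using M(1) by simp
  ultimately show ?thesis by blast
qed

lemma move_1354276:
  assumes "distinct (S1 @ S2 @ S3 @ S4 @ S5 @ S6 @ S7)" "[] \<notin> {S1, S2, S3, S4, S5, S6, S7}" "last ` {S1, S2, S3, S4, S5, S6, S7} \<subseteq> A"
  shows "\<exists>zs. move A (S1 @ S2 @ S3 @ S4 @ S5 @ S6 @ S7) zs \<and>
    nxt zs (last S1) = hd S3 \<and> nxt zs (last S2) = hd S7 \<and> nxt zs (last S3) = hd S5 \<and> nxt zs (last S4) = hd S2 \<and> nxt zs (last S5) = hd S4 \<and> nxt zs (last S6) = hd S1 \<and> nxt zs (last S7) = hd S6"
proof -
  have N: "nxt [S1, S2, S3, S4, S5, S6, S7] S1 = S2 \<and> nxt [S1, S2, S3, S4, S5, S6, S7] S2 = S3 \<and> nxt [S1, S2, S3, S4, S5, S6, S7] S3 = S4 \<and> nxt [S1, S2, S3, S4, S5, S6, S7] S4 = S5 \<and> nxt [S1, S2, S3, S4, S5, S6, S7] S5 = S6 \<and> nxt [S1, S2, S3, S4, S5, S6, S7] S6 = S7 \<and> nxt [S1, S2, S3, S4, S5, S6, S7] S7 = S1"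
    "nxt [S1, S3, S5, S4, S2, S7, S6] S1 = S3 \<and> nxt [S1, S3, S5, S4, S2, S7, S6] S2 = S7 \<and> nxt [S1, S3, S5, S4, S2, S7, S6] S3 = S5 \<and> nxt [S1, S3, S5, S4, S2, S7, S6] S4 = S2 \<and> nxt [S1, S3, S5, S4, S2, S7, S6] S5 = S4 \<and> nxt [S1, S3, S5, S4, S2, S7, S6] S6 = S1 \<and> nxt [S1, S3, S5, S4, S2, S7, S6] S7 = S6"
    if "distinct [S1, S2, S3, S4, S5, S6, S7]"
    using that by (auto simp: nxt_def)
  have T: "set [S1, S3, S5, S4, S2, S7, S6] = set [S1, S2, S3, S4, S5, S6, S7] \<and> distinct [S1, S3, S5, S4, S2, S7, S6] \<and> adj [S1, S2, S3, S4, S5, S6, S7] [S1, S3, S5, S4, S2, S7, S6]" if d: "distinct [S1, S2, S3, S4, S5, S6, S7]"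
  proof (intro conjI)
    show "adj [S1, S2, S3, S4, S5, S6, S7] [S1, S3, S5, S4, S2, S7, S6]"
      by (rule adjI[of "[S1, S2, S6, S7, S5, S3, S4]"]) (use N[OF d] d in auto)
  qed (use d in auto)
  have "distinct (concat [S1, S2, S3, S4, S5, S6, S7])" "[] \<notin> set [S1, S2, S3, S4, S5, S6, S7]" "\<forall>S\<in>set [S1, S2, S3, S4, S5, S6, S7]. last S \<in> A"
    using assms by auto
  note M = move_concat[OF this T]
  have "nxt (S1 @ S3 @ S5 @ S4 @ S2 @ S7 @ S6) (last S1) = hd S3 \<and> nxt (S1 @ S3 @ S5 @ S4 @ S2 @ S7 @ S6) (last S2) = hd S7 \<and> nxt (S1 @ S3 @ S5 @ S4 @ S2 @ S7 @ S6) (last S3) = hd S5 \<and> nxt (S1 @ S3 @ S5 @ S4 @ S2 @ S7 @ S6) (last S4) = hd S2 \<and> nxt (S1 @ S3 @ S5 @ S4 @ S2 @ S7 @ S6) (last S5) = hd S4 \<and> nxt (S1 @ S3 @ S5 @ S4 @ S2 @ S7 @ S6) (last S6) = hd S1 \<and> nxt (S1 @ S3 @ S5 @ S4 @ S2 @ S7 @ S6) (last S7) = hd S6"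
    using M(2) N(2)[OF M(3)] by simp
  moreover have "move A (S1 @ S2 @ S3 @ S4 @ S5 @ S6 @ S7) (S1 @ S3 @ S5 @ S4 @ S2 @ S7 @ S6)"
    using M(1) by simp
  ultimately show ?thesis by blast
qed

section \<open>Exchanges with prescribed successors\<close>

lemma card_filter_set: "distinct L \<Longrightarrow> card (Z \<inter> set L) = length (filter (\<lambda>z. z \<in> Z) L)"
proof -
  assume "distinct L"
  moreover have "Z \<inter> set L = set (filter (\<lambda>z. z \<in> Z) L)" by auto
  ultimately show ?thesis by (metis distinct_card distinct_filter)
qed

lemma hd_append_Cons: "r \<noteq> [] \<Longrightarrow> hd (C @ c # r) = hd (C @ [c])"
  by (simp add: hd_append)

lemma filter_eq_ConsE:
  assumes "filter P L = x # r"
  obtains A B where "L = A @ [x] @ B" "P x" "filter P B = r"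
  using assms by (auto simp: filter_eq_Cons_iff)

lemma split_list_two:
  assumes "distinct L" "2 \<le> card (Z \<inter> set L)"
  shows "\<exists>A z B u C. L = A @ [z] @ B @ [u] @ C \<and> z \<in> Z \<and> u \<in> Z"
proof -
  obtain z u r where "filter (\<lambda>z. z \<in> Z) L = z # u # r"
    using assms by (auto simp: card_filter_set numeral_2_eq_2 Suc_le_length_iff)
  then obtain A B C where "L = A @ [z] @ B @ [u] @ C" "z \<in> Z" "u \<in> Z"
    by (elim filter_eq_ConsE) simp
  then show ?thesis by blast
qed

lemma split_list_three:
  assumes "distinct L" "3 \<le> card (Z \<inter> set L)"
  shows "\<exists>A z B u C w D. L = A @ [z] @ B @ [u] @ C @ [w] @ D \<and> z \<in> Z \<and> u \<in> Z \<and> w \<in> Z"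
proof -
  obtain z u w r where "filter (\<lambda>z. z \<in> Z) L = z # u # w # r"
    using assms by (auto simp: card_filter_set numeral_3_eq_3 Suc_le_length_iff)
  then obtain A B C D where "L = A @ [z] @ B @ [u] @ C @ [w] @ D" "z \<in> Z" "u \<in> Z" "w \<in> Z"
    by (elim filter_eq_ConsE) simp
  then show ?thesis by blast
qed

lemma nxt_end: "distinct (P @ [a] @ Q) \<Longrightarrow> nxt (P @ [a] @ Q) a = hd (Q @ P @ [a])"
  using nxt_split[of a P Q] by simp

text \<open>
  The element \<open>x\<close> cuts the segment from the new successor of \<open>p\<close> back to \<open>p\<close>, which would otherwise
  close up to a short cycle. Which exchange works depends on the cyclic order of \<open>p\<close>, \<open>y\<close>, \<open>q\<close> and
  the candidates in \<open>Z\<close>; four candidates leave, by pigeonhole, enough of them in one gap.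
\<close>

lemma move_two_targets:
  assumes d: "distinct (S1 @ [y] @ S2 @ [p])" and A: "{p, q, y} \<subseteq> A" "Z \<subseteq> A"
    and q: "q \<in> set (S1 @ [y] @ S2)" and Z: "Z \<subseteq> set (S1 @ S2)" "q \<notin> Z" "4 \<le> card Z"
    and x: "x \<in> set S2" "x \<in> A"
  shows "\<exists>zs. move A (S1 @ [y] @ S2 @ [p]) zs \<and> nxt zs p = hd (S2 @ [p]) \<and>
    (\<exists>z\<in>Z. nxt zs q = nxt (S1 @ [y] @ S2 @ [p]) z)"
proof -
  have fin: "finite Z" using Z(1) finite_subset by blast
  have dd: "distinct S1" "distinct S2" "set S1 \<inter> set S2 = {}" using d by auto
  have cardU: "card Z \<le> card (Z \<inter> set L) + card (Z \<inter> set M)" if "Z \<subseteq> set L \<union> set M" for L M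
    using that fin by (metis Int_Un_distrib card_Un_le inf.absorb1)
  \<comment> \<open>The element \<open>y\<close> gives up its successor to \<open>p\<close>; the
    cases are the positions of \<open>q\<close> relative to \<open>y\<close> in the list ending with
    \<open>p\<close>.\<close>
  consider (eq) "q = y" | (right) "q \<in> set S2" | (left) "q \<in> set S1" using q by auto
  then show ?thesis
  proof cases
    case eq
    show ?thesis
    \<comment> \<open>When \<open>q = y\<close>, a candidate in \<open>S2\<close> makes three arcs
      suffice. Otherwise all candidates lie in \<open>S1\<close>, and two of them together with
      \<open>x\<close> serve as cuts.\<close>
    proof (cases "Z \<inter> set S2 = {}")
      case False
      then obtain z B C where ZZ: "z \<in> Z" and z: "S2 = B @ [z] @ C" by (metis disjoint_iff split_list append_Cons append_Nil)
      have "\<exists>zs. move A (S1 @ [y] @ S2 @ [p]) zs \<and> nxt zs p = hd (S2 @ [p]) \<and> nxt zs q = nxt (S1 @ [y] @ S2 @ [p]) z"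
        using move_132[of "S1 @ [y]" "B @ [z]" "C @ [p]" A] d A ZZ[THEN subsetD[OF A(2)]] z eq nxt_end[of "S1 @ [y] @ B" z "C @ [p]"]
        by (auto simp: hd_append_Cons)
      then show ?thesis using ZZ by blast
    next
      case True
      then have "2 \<le> card (Z \<inter> set S1)" using cardU[of S1 S2] Z by simp
      then obtain P z B u C where S1: "S1 = P @ [z] @ B @ [u] @ C" and ZZ: "z \<in> Z" "u \<in> Z"
        using split_list_two dd by blast
      obtain D E where S2: "S2 = D @ [x] @ E" using x by (metis split_list append_Cons append_Nil)
      have "\<exists>zs. move A (S1 @ [y] @ S2 @ [p]) zs \<and> nxt zs p = hd (S2 @ [p]) \<and> nxt zs q = nxt (S1 @ [y] @ S2 @ [p]) z"
        using move_13254[of "P @ [z]" "B @ [u]" "C @ [y]" "D @ [x]" "E @ [p]" A] d A ZZ[THEN subsetD[OF A(2)]] S1 S2 eq x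
          nxt_end[of P z "B @ [u] @ C @ [y] @ S2 @ [p]"]
        by (auto simp: hd_append_Cons)
      then show ?thesis using ZZ by blast
    qed
  next
    case right
    then obtain C D where S2: "S2 = C @ [q] @ D" by (metis split_list append_Cons append_Nil)
    have "card (Z \<inter> set S2) \<le> card (Z \<inter> set C) + card (Z \<inter> set D)"
      using Z(2) fin by (intro order.trans[OF card_mono card_Un_le]) (auto simp: S2)
    \<comment> \<open>Four candidates in three gaps: some gap contains two. Of these,
      \<open>z\<close> passes its successor to \<open>q\<close>, while \<open>u\<close> is only a
      further cut.\<close>
    then consider "2 \<le> card (Z \<inter> set S1)" | "2 \<le> card (Z \<inter> set C)" | "2 \<le> card (Z \<inter> set D)"
      using cardU[of S1 S2] Z by fastforce
    then show ?thesis
    proof cases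
      case 1
      then obtain P z B u E where S1: "S1 = P @ [z] @ B @ [u] @ E" and ZZ: "z \<in> Z" "u \<in> Z"
        using split_list_two dd by blast
      have "\<exists>zs. move A (S1 @ [y] @ S2 @ [p]) zs \<and> nxt zs p = hd (S2 @ [p]) \<and> nxt zs q = nxt (S1 @ [y] @ S2 @ [p]) z"
        using move_13542[of "P @ [z]" "B @ [u]" "E @ [y]" "C @ [q]" "D @ [p]" A] d A ZZ[THEN subsetD[OF A(2)]] S1 S2
          nxt_end[of P z "B @ [u] @ E @ [y] @ S2 @ [p]"]
        by (auto simp: hd_append_Cons)
      then show ?thesis using ZZ by blast
    next
      case 2
      then obtain P z B u E where C: "C = P @ [z] @ B @ [u] @ E" and ZZ: "z \<in> Z" "u \<in> Z"
        using split_list_two[of C Z] dd S2 by auto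
      have "\<exists>zs. move A (S1 @ [y] @ S2 @ [p]) zs \<and> nxt zs p = hd (S2 @ [p]) \<and> nxt zs q = nxt (S1 @ [y] @ S2 @ [p]) z"
        using move_15243[of "S1 @ [y]" "P @ [z]" "B @ [u]" "E @ [q]" "D @ [p]" A] d A ZZ[THEN subsetD[OF A(2)]] C S2
          nxt_end[of "S1 @ [y] @ P" z "B @ [u] @ E @ [q] @ D @ [p]"]
        by (auto simp: hd_append_Cons)
      then show ?thesis using ZZ by blast
    next
      case 3
      then obtain P z B u E where D: "D = P @ [z] @ B @ [u] @ E" and ZZ: "z \<in> Z" "u \<in> Z"
        using split_list_two[of D Z] dd S2 by auto
      have "\<exists>zs. move A (S1 @ [y] @ S2 @ [p]) zs \<and> nxt zs p = hd (S2 @ [p]) \<and> nxt zs q = nxt (S1 @ [y] @ S2 @ [p]) z"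
        using move_15243[of "S1 @ [y]" "C @ [q]" "P @ [z]" "B @ [u]" "E @ [p]" A] d A ZZ[THEN subsetD[OF A(2)]] D S2
          nxt_end[of "S1 @ [y] @ C @ [q] @ P" z "B @ [u] @ E @ [p]"]
        by (auto simp: hd_append_Cons)
      then show ?thesis using ZZ by blast
    qed
  next
    case left
    then obtain P B where S1: "S1 = P @ [q] @ B" by (metis split_list append_Cons append_Nil)
    obtain D E where S2: "S2 = D @ [x] @ E" using x by (metis split_list append_Cons append_Nil)
    have "card (Z \<inter> set S1) \<le> card (Z \<inter> set P)" if "Z \<inter> set B = {}"
      using Z(2) fin that by (intro card_mono) (auto simp: S1)
    \<comment> \<open>If the gap between \<open>q\<close> and \<open>y\<close> is empty of
      candidates and \<open>S2\<close> has at most one, three remain in front of \<open>q\<close>.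
      That last configuration takes seven arcs, with two of the three candidates as mere
      cuts.\<close>
    then consider "Z \<inter> set B \<noteq> {}" | "2 \<le> card (Z \<inter> set S2)" | "3 \<le> card (Z \<inter> set P)"
      using cardU[of S1 S2] Z by fastforce
    then show ?thesis
    proof cases
      case 1
      then obtain z B1 B2 where ZZ: "z \<in> Z" and z: "B = B1 @ [z] @ B2" by (metis disjoint_iff split_list append_Cons append_Nil)
      have "\<exists>zs. move A (S1 @ [y] @ S2 @ [p]) zs \<and> nxt zs p = hd (S2 @ [p]) \<and> nxt zs q = nxt (S1 @ [y] @ S2 @ [p]) z"
        using move_13254[of "P @ [q]" "B1 @ [z]" "B2 @ [y]" "D @ [x]" "E @ [p]" A] d A ZZ[THEN subsetD[OF A(2)]] z S1 S2 x
          nxt_end[of "P @ [q] @ B1" z "B2 @ [y] @ S2 @ [p]"]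
        by (auto simp: hd_append_Cons)
      then show ?thesis using ZZ by blast
    next
      case 2
      then obtain D z B' u E where C: "S2 = D @ [z] @ B' @ [u] @ E" and ZZ: "z \<in> Z" "u \<in> Z"
        using split_list_two dd by blast
      have "\<exists>zs. move A (S1 @ [y] @ S2 @ [p]) zs \<and> nxt zs p = hd (S2 @ [p]) \<and> nxt zs q = nxt (S1 @ [y] @ S2 @ [p]) z"
        using move_14253[of "P @ [q]" "B @ [y]" "D @ [z]" "B' @ [u]" "E @ [p]" A] d A ZZ[THEN subsetD[OF A(2)]] C S1
          nxt_end[of "P @ [q] @ B @ [y] @ D" z "B' @ [u] @ E @ [p]"]
        by (auto simp: hd_append_Cons)
      then show ?thesis using ZZ by blast
    next
      case 3
      then obtain P1 z P2 u P3 w P4 where P: "P = P1 @ [z] @ P2 @ [w] @ P3 @ [u] @ P4" and ZZ: "z \<in> Z" "u \<in> Z" "w \<in> Z"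
        using split_list_three[of P Z] dd S1 by auto
      have "\<exists>zs. move A (S1 @ [y] @ S2 @ [p]) zs \<and> nxt zs p = hd (S2 @ [p]) \<and> nxt zs q = nxt (S1 @ [y] @ S2 @ [p]) z"
        using move_1354276[of "P1 @ [z]" "P2 @ [w]" "P3 @ [u]" "P4 @ [q]" "B @ [y]" "D @ [x]" "E @ [p]" A] d A ZZ[THEN subsetD[OF A(2)]] P S1 S2 x
          nxt_end[of P1 z "P2 @ [w] @ P3 @ [u] @ P4 @ [q] @ B @ [y] @ S2 @ [p]"]
        by (auto simp: hd_append_Cons)
      then show ?thesis using ZZ by blast
    qed
  qed
qed

text \<open>Three arcs suffice once some \<open>x\<close> between \<open>y\<close> and
  \<open>p\<close> may change: \<open>p\<close> takes over the successor of \<open>y\<close>,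
  \<open>y\<close> that of \<open>x\<close>, and \<open>x\<close> that of \<open>p\<close>.\<close>

lemma move_target:
  assumes d: "distinct (S1 @ [y] @ S2 @ [p])" and A: "{p, x, y} \<subseteq> A" and x: "x \<in> set S2"
  shows "\<exists>zs. move A (S1 @ [y] @ S2 @ [p]) zs \<and> nxt zs p = hd (S2 @ [p])"
proof -
  obtain D E where S2: "S2 = D @ [x] @ E" using x by (metis split_list append_Cons append_Nil)
  then show ?thesis
    using move_132[of "S1 @ [y]" "D @ [x]" "E @ [p]" A] d A by (auto simp: hd_append_Cons)
qed

section \<open>A long walk through cyclic permutations\<close>

text \<open>Each list stands for a cyclic permutation. Rotations of a list are different members of
  this set, which is why later statements compare members through \<open>nxt\<close>.\<close>

definition tours :: "nat \<Rightarrow> nat list set" where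
  "tours N = {xs. distinct xs \<and> set xs = {..<N}}"

definition agree :: "nat \<Rightarrow> nat list \<Rightarrow> nat list \<Rightarrow> bool" where
  "agree i xs ys \<longleftrightarrow> (\<forall>j<i. nxt xs j = nxt ys j)"

definition valid :: "nat \<Rightarrow> nat \<Rightarrow> nat list \<Rightarrow> nat \<Rightarrow> bool" where
  "valid N i xs h \<longleftrightarrow> (\<exists>ys\<in>tours N. agree i xs ys \<and> nxt ys i = h)"

text \<open>The smallest label belongs to the successor in \<open>[0..<N]\<close>: \<open>lab N (Suc i mod N) = i\<close>.\<close>

definition lab :: "nat \<Rightarrow> nat \<Rightarrow> nat" where
  "lab N h = (if h = 0 then N - 1 else h - 1)"

lemma agree_trans: "agree i xs ys \<Longrightarrow> agree i ys zs \<Longrightarrow> agree i xs zs"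
  by (simp add: agree_def)

lemma agree_sym: "agree i xs ys \<Longrightarrow> agree i ys xs"
  by (simp add: agree_def)

lemma agree_refl: "agree i xs xs"
  by (simp add: agree_def)

lemma valid_cong: "agree i xs ys \<Longrightarrow> valid N i xs h \<longleftrightarrow> valid N i ys h"
  unfolding valid_def by (meson agree_sym agree_trans)

lemma lab_inj: "h < N \<Longrightarrow> h' < N \<Longrightarrow> lab N h = lab N h' \<longleftrightarrow> h = h'"
  by (auto simp: lab_def)

lemma lab_less: "h < N \<Longrightarrow> lab N h < N"
  by (auto simp: lab_def)

lemma tours_nxt_less: "xs \<in> tours N \<Longrightarrow> i < N \<Longrightarrow> nxt xs i < N"
  using nxt_in_set[of xs i] by (auto simp: tours_def)

lemma tours_nxt_inj: "xs \<in> tours N \<Longrightarrow> i < N \<Longrightarrow> j < N \<Longrightarrow> nxt xs i = nxt xs j \<longleftrightarrow> i = j"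
  using inj_on_nxt[of xs] by (auto simp: tours_def inj_on_def)

lemma tours_nxt_surj: "xs \<in> tours N \<Longrightarrow> h < N \<Longrightarrow> \<exists>i<N. nxt xs i = h"
  using nxt_image[of xs] by (auto simp: tours_def image_iff set_eq_iff) metis

lemma tours_adj_cong:
  assumes "adj ys zs" "xs \<in> tours N" "ys \<in> tours N" "\<And>a. a < N \<Longrightarrow> nxt ys a = nxt xs a"
  shows "adj xs zs"
proof -
  have "set xs = {..<N}" "set ys = {..<N}" using assms(2,3) unfolding tours_def by blast+
  then show ?thesis by (intro adj_cong[OF assms(1)]) (use assms(4) in auto)
qed

text \<open>With \<open>p\<close> in last position, the stretch from a prospective successor of
  \<open>p\<close> back to \<open>p\<close> is a suffix of the list, so wrap-around needs no
  separate cases.\<close>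

lemma rotate_to_end:
  assumes "xs \<in> tours N" "p < N"
  obtains ys where "ys @ [p] \<in> tours N" "\<And>a. a < N \<Longrightarrow> nxt (ys @ [p]) a = nxt xs a"
proof -
  have "p \<in> set xs" using assms by (simp add: tours_def)
  then obtain P Q where "xs = P @ p # Q" by (meson split_list)
  then have xs: "xs = (P @ [p]) @ Q" by simp
  show ?thesis
  proof (rule that[of "Q @ P"])
    show "(Q @ P) @ [p] \<in> tours N" using assms(1) by (auto simp: xs tours_def)
    show "nxt ((Q @ P) @ [p]) a = nxt xs a" if "a < N" for a
      using nxt_rotate[of "P @ [p]" Q a] assms(1) that by (auto simp: xs tours_def)
  qed
qed

lemma split_at_target:
  assumes "ys @ [p] \<in> tours N" "h < N" "h \<noteq> nxt (ys @ [p]) p"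
  obtains S1 y S2 where "ys = S1 @ [y] @ S2" "hd (S2 @ [p]) = h" "nxt (ys @ [p]) y = h" "y < N"
proof -
  obtain y where y: "y < N" "nxt (ys @ [p]) y = h" using tours_nxt_surj[OF assms(1,2)] by blast
  have "set (ys @ [p]) = {..<N}" using assms(1) by (simp add: tours_def)
  then have "y \<in> set (ys @ [p])" using y(1) by blast
  moreover have "y \<noteq> p" using y(2) assms(3) by blast
  ultimately have "y \<in> set ys" by simp
  then obtain S1 S2 where "ys = S1 @ y # S2" by (meson split_list)
  then have S: "ys = S1 @ [y] @ S2" by simp
  have "nxt (ys @ [p]) y = hd (S2 @ [p])"
    using nxt_end[of S1 y "S2 @ [p]"] assms(1) by (auto simp: S tours_def hd_append)
  then show ?thesis using that S y by metis
qed

lemma valid_imp_free: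
  assumes R: "S1 @ [y] @ S2 @ [i] \<in> tours N" and h: "h = hd (S2 @ [i])"
    and v: "valid N i (S1 @ [y] @ S2 @ [i]) h" and ne: "h \<noteq> nxt (S1 @ [y] @ S2 @ [i]) i"
  shows "\<exists>x\<in>set S2. i < x" "i < y"
proof -
  let ?R = "S1 @ [y] @ S2 @ [i]"
  obtain ys where ys: "ys \<in> tours N" "agree i ?R ys" "nxt ys i = h" using v by (auto simp: valid_def)
  have d: "distinct ?R" "set ?R = {..<N}" using R by (auto simp: tours_def)
  then have less: "i < N" "y < N" by auto
  have yh: "nxt ?R y = h" using nxt_end[of S1 y "S2 @ [i]"] d by (simp add: h hd_append)
  have "y \<noteq> i" using d by auto
  moreover have "\<not> y < i"
  proof
    assume "y < i"
    then have "nxt ys y = nxt ys i" using ys yh by (simp add: agree_def)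
    then show False using tours_nxt_inj[OF ys(1) less(2,1)] \<open>y < i\<close> by simp
  qed
  ultimately show "i < y" by simp
  show "\<exists>x\<in>set S2. i < x"
  proof (rule ccontr)
    assume neg: "\<not> (\<exists>x\<in>set S2. i < x)"
    have "i \<notin> set S2" using d by auto
    then have S2: "x < i" if "x \<in> set S2" for x using neg that by (metis linorder_neqE_nat)
    have "set (S2 @ [i]) = set ys"
    proof (rule nxt_closed_imp_all)
      show "distinct ys" "set (S2 @ [i]) \<subseteq> set ys" using ys(1) d by (auto simp: tours_def)
      fix a assume a: "a \<in> set (S2 @ [i])"
      show "nxt ys a \<in> set (S2 @ [i])"
      proof (cases "a = i")
        case True
        then show ?thesis using ys(3) h by (metis hd_in_set append_is_Nil_conv list.distinct(1))
      next
        case False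
        then have a: "a \<in> set S2" using a by simp
        then obtain C D where "S2 = C @ [a] @ D" by (metis split_list append_Cons append_Nil)
        then have "nxt ?R a \<in> set (S2 @ [i])"
          using nxt_end[of "S1 @ [y] @ C" a "D @ [i]"] d by (auto simp: hd_append)
        then show ?thesis using S2[OF a] ys(2) by (simp add: agree_def)
      qed
    qed simp
    moreover have "y \<in> set ys" "y \<notin> set (S2 @ [i])" using ys(1) d less by (auto simp: tours_def)
    ultimately show False by blast
  qed
qed

lemma move_tours:
  assumes "xs \<in> tours N" "i \<le> N" "move {i..} xs zs"
  shows "zs \<in> tours N" "agree i xs zs" "adj xs zs"
  using assms by (auto simp: tours_def move_def agree_def)

text \<open>One exchange of three arcs realises any valid successor, without control over the
  successors of larger elements.\<close>

lemma short_step: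
  assumes xs: "xs \<in> tours N" and i: "i < N" and v: "valid N i xs h" and ne: "h \<noteq> nxt xs i"
  shows "\<exists>zs\<in>tours N. adj xs zs \<and> agree i xs zs \<and> nxt zs i = h"
proof -
  obtain ys where ys: "ys @ [i] \<in> tours N" "\<And>a. a < N \<Longrightarrow> nxt (ys @ [i]) a = nxt xs a"
    using rotate_to_end[OF xs i] by blast
  have ag: "agree i xs (ys @ [i])" using ys(2) i by (simp add: agree_def)
  have h: "h < N" "h \<noteq> nxt (ys @ [i]) i" using v ne tours_nxt_less i ys(2) by (auto simp: valid_def)
  obtain S1 y S2 where S: "ys = S1 @ [y] @ S2" "hd (S2 @ [i]) = h" "nxt (ys @ [i]) y = h" "y < N"
    using split_at_target[OF ys(1) h] by blast
  let ?R = "S1 @ [y] @ S2 @ [i]"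
  have R: "?R \<in> tours N" using ys S by simp
  have "valid N i ?R h" using v valid_cong[OF ag] S by simp
  then obtain x where x: "x \<in> set S2" "i < x" "i < y"
    using valid_imp_free[OF R] S h by force
  obtain zs where zs: "move {i..} ?R zs" "nxt zs i = h"
    using move_target[of S1 y S2 i x "{i..}"] x R S by (auto simp: tours_def)
  have "adj xs zs"
    by (rule tours_adj_cong[OF move_tours(3)[OF R _ zs(1)] xs R]) (use i ys(2) S(1) in auto)
  moreover have "agree i xs zs" using agree_trans[OF ag] move_tours(2)[OF R _ zs(1)] i S by simp
  moreover have "zs \<in> tours N" using move_tours(1)[OF R _ zs(1)] i by simp
  ultimately show ?thesis using zs(2) by blast
qed

lemma long_step:
  assumes xs: "xs \<in> tours N" and i: "Suc i < N" and v: "valid N i xs h" and ne: "h \<noteq> nxt xs i"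
    and T: "T \<subseteq> {..<N} - nxt xs ` {..<i} - {h}" "6 \<le> card T"
  shows "\<exists>zs\<in>tours N. adj xs zs \<and> agree i xs zs \<and> nxt zs i = h \<and> nxt zs (Suc i) \<in> T"
proof -
  have iN: "i < N" using i by simp
  obtain ys where ys: "ys @ [i] \<in> tours N" "\<And>a. a < N \<Longrightarrow> nxt (ys @ [i]) a = nxt xs a"
    using rotate_to_end[OF xs iN] by blast
  have ag: "agree i xs (ys @ [i])" using ys(2) i by (simp add: agree_def)
  have h: "h < N" "h \<noteq> nxt (ys @ [i]) i" using v ne tours_nxt_less i ys(2) by (auto simp: valid_def)
  obtain S1 y S2 where S: "ys = S1 @ [y] @ S2" "hd (S2 @ [i]) = h" "nxt (ys @ [i]) y = h" "y < N"
    using split_at_target[OF ys(1) h] by blast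
  let ?R = "S1 @ [y] @ S2 @ [i]"
  have R: "?R \<in> tours N" using ys S by simp
  have "valid N i ?R h" using v valid_cong[OF ag] S by simp
  then obtain x where x: "x \<in> set S2" "i < x" "i < y"
    using valid_imp_free[OF R] S h by force
  \<comment> \<open>The candidates are the present owners of targets in \<open>T\<close>. The
    elements \<open>i\<close> and \<open>Suc i\<close> are removed because they play the roles of
    \<open>p\<close> and \<open>q\<close>; six targets therefore leave at least four
    candidates.\<close>
  define Z where "Z = {z. z < N \<and> nxt xs z \<in> T} - {i, Suc i}"
  have "nxt xs ` {z. z < N \<and> nxt xs z \<in> T} = T"
  proof (intro equalityI subsetI)
    fix t assume "t \<in> T"
    moreover from this obtain j where "j < N" "nxt xs j = t" using tours_nxt_surj[OF xs, of t] T(1) by blast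
    ultimately show "t \<in> nxt xs ` {z. z < N \<and> nxt xs z \<in> T}" by blast
  qed blast
  then have "card T \<le> card {z. z < N \<and> nxt xs z \<in> T}"
    using card_image_le[of "{z. z < N \<and> nxt xs z \<in> T}" "nxt xs"] by simp
  then have cZ: "4 \<le> card Z"
    using T(2) diff_card_le_card_Diff[of "{i, Suc i}" "{z. z < N \<and> nxt xs z \<in> T}"] by (simp add: Z_def)
  have yZ: "y \<notin> Z" using S ys T by (auto simp: Z_def)
  have ZA: "Z \<subseteq> {i..}"
  proof
    fix z assume "z \<in> Z"
    then have "nxt xs z \<notin> nxt xs ` {..<i}" using T(1) by (auto simp: Z_def)
    then show "z \<in> {i..}" by auto
  qed
  have setR: "set ?R = {..<N}" "distinct ?R" using R by (auto simp: tours_def)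
  have "Z \<subseteq> set (S1 @ S2)"
  proof
    fix z assume z: "z \<in> Z"
    then have "z \<in> set ?R" by (simp only: setR) (simp add: Z_def)
    then show "z \<in> set (S1 @ S2)" using z yZ by (auto simp: Z_def)
  qed
  moreover have "Suc i \<in> set (S1 @ [y] @ S2)"
  proof -
    have "Suc i \<in> set ?R" using i by (simp only: setR) simp
    then show ?thesis by auto
  qed
  ultimately obtain zs z where zs: "move {i..} ?R zs" "nxt zs i = hd (S2 @ [i])" "z \<in> Z" "nxt zs (Suc i) = nxt ?R z"
    using move_two_targets[of S1 y S2 i "Suc i" "{i..}" Z x] setR(2) x ZA cZ by (auto simp: Z_def)
  have "adj xs zs"
    by (rule tours_adj_cong[OF move_tours(3)[OF R _ zs(1)] xs R]) (use i ys(2) S(1) in auto)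
  moreover have "agree i xs zs" using agree_trans[OF ag] move_tours(2)[OF R _ zs(1)] i S by simp
  moreover have "nxt zs (Suc i) \<in> T" using zs(3,4) ys(2)[of z] S by (auto simp: Z_def)
  moreover have "zs \<in> tours N" using move_tours(1)[OF R _ zs(1)] i by simp
  moreover have "nxt zs i = h" using zs(2) S by simp
  ultimately show ?thesis by blast
qed

text \<open>At most one unused successor of \<open>i\<close> closes a short cycle.\<close>

lemma card_unused_le:
  assumes xs: "xs \<in> tours N" and i: "i < N"
  shows "card {h. h < N \<and> lab N h < l \<and> h \<notin> nxt xs ` {..i}} \<le> Suc (card {h. valid N i xs h \<and> lab N h < l})"
proof -
  let ?W = "{h. h < N \<and> lab N h < l \<and> h \<notin> nxt xs ` {..i}}" and ?V = "{h. valid N i xs h \<and> lab N h < l}"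
  obtain ys where ys: "ys @ [i] \<in> tours N" "\<And>a. a < N \<Longrightarrow> nxt (ys @ [i]) a = nxt xs a"
    using rotate_to_end[OF xs i] by blast
  have *: "\<exists>S1 y S2. ys = S1 @ [y] @ S2 \<and> hd (S2 @ [i]) = h \<and> i < y \<and> (\<forall>x\<in>set S2. x \<le> i)"
    if h: "h \<in> ?W" "\<not> valid N i xs h" for h
  proof -
    have "h \<noteq> nxt (ys @ [i]) i" using h ys(2)[OF i] by auto
    then obtain S1 y S2 where S: "ys = S1 @ [y] @ S2" "hd (S2 @ [i]) = h" "nxt (ys @ [i]) y = h" "y < N"
      using split_at_target[OF ys(1), of h] h by blast
    have "nxt xs y \<notin> nxt xs ` {..i}" using S ys(2) h by auto
    then have y: "i < y" by (metis atMost_iff imageI not_le)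
    have "\<not> i < x" if x: "x \<in> set S2" for x
    proof
      assume "i < x"
      then obtain zs where "move {i..} (S1 @ [y] @ S2 @ [i]) zs" "nxt zs i = h"
        using move_target[of S1 y S2 i x "{i..}"] x y ys(1) S by (auto simp: tours_def)
      then have "valid N i (ys @ [i]) h"
        using move_tours(1,2)[OF ys(1)] i S unfolding valid_def by (metis append_assoc less_imp_le)
      moreover have "agree i xs (ys @ [i])" using ys(2) i by (simp add: agree_def)
      ultimately show False using h(2) valid_cong by blast
    qed
    then show ?thesis using S y by (metis not_le)
  qed
  have "h = h'" if hh: "h \<in> ?W" "\<not> valid N i xs h" "h' \<in> ?W" "\<not> valid N i xs h'" for h h'
  proof -
    obtain S1 y S2 where S: "ys = S1 @ [y] @ S2" "hd (S2 @ [i]) = h" "i < y" "\<forall>x\<in>set S2. x \<le> i"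
      using *[OF hh(1,2)] by blast
    obtain T1 z T2 where T: "ys = T1 @ [z] @ T2" "hd (T2 @ [i]) = h'" "i < z" "\<forall>x\<in>set T2. x \<le> i"
      using *[OF hh(3,4)] by blast
    \<comment> \<open>So \<open>S2\<close> is the longest suffix of \<open>ys\<close> with entries
      at most \<open>i\<close>. It does not depend on \<open>h\<close>, and it determines
      \<open>h\<close>.\<close>
    have "takeWhile (\<lambda>x. x \<le> i) (rev ys) = rev S2" using S by (simp add: takeWhile_append)
    moreover have "takeWhile (\<lambda>x. x \<le> i) (rev ys) = rev T2" using T by (simp add: takeWhile_append)
    ultimately show ?thesis using S T by simp
  qed
  then have "card (?W - ?V) \<le> 1" 
    by (intro card_le_Suc0_iff_eq[THEN iffD2, simplified One_nat_def[symmetric]]) auto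
  moreover have "finite ?V" by (rule finite_subset[of _ "{..<N}"]) (use tours_nxt_less i in \<open>auto simp: valid_def\<close>)
  then have "card ?W \<le> card (?W - ?V) + card ?V"
    by (intro order.trans[OF card_mono card_Un_le]) auto
  ultimately show ?thesis by linarith
qed

section \<open>The recursion for the length of the walk\<close>

lemma finite_has_max_value:
  fixes f :: "'a \<Rightarrow> nat"
  assumes "finite S" "S \<noteq> {}"
  obtains m where "m \<in> S" "\<forall>u\<in>S. f u \<le> f m"
proof -
  have "Max (f ` S) \<in> f ` S" using assms by (intro Max_in) auto
  then obtain m where "m \<in> S" "f m = Max (f ` S)" by auto
  then show ?thesis using that[of m] assms(1) by simp
qed

lemma exists_upper_subset:
  fixes f :: "'a \<Rightarrow> nat"
  assumes "finite U" "inj_on f U" "k \<le> card U"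
  shows "\<exists>T\<subseteq>U. card T = k \<and> (\<forall>t\<in>T. \<forall>u\<in>U - T. f u < f t)"
  using assms(3)
proof (induction k)
  case 0
  show ?case by (intro exI[of _ "{}"]) simp
next
  case (Suc k)
  then obtain T where T: "T \<subseteq> U" "card T = k" "\<forall>t\<in>T. \<forall>u\<in>U - T. f u < f t" by auto
  then have "U - T \<noteq> {}" using Suc.prems by auto
  moreover have fin: "finite (U - T)" using assms(1) by simp
  ultimately obtain m where m: "m \<in> U - T" "\<forall>u\<in>U - T. f u \<le> f m"
    using finite_has_max_value by blast
  have "f u < f m" if "u \<in> U - insert m T" for u
  proof -
    have "f u \<noteq> f m" using assms(2) that m(1) by (auto simp: inj_on_def)
    then show ?thesis using m(2) that by (simp add: le_neq_implies_less)
  qed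
  moreover have "card (insert m T) = Suc k" using T m assms(1) finite_subset[OF T(1)] by simp
  ultimately show ?case using T m by (intro exI[of _ "insert m T"]) auto
qed

text \<open>Adjacency will make the pair an edge of both polytopes; the last condition is the
  lexicographic decrease of the labels of the successors of \<open>0, 1, 2, ...\<close>.\<close>

definition step :: "nat \<Rightarrow> nat list \<Rightarrow> nat list \<Rightarrow> bool" where
  "step N xs zs \<longleftrightarrow> xs \<in> tours N \<and> zs \<in> tours N \<and> adj xs zs \<and>
     (\<exists>i<N. agree i xs zs \<and> lab N (nxt zs i) < lab N (nxt xs i))"

text \<open>Its size is the potential of level \<open>i\<close>: how often the successor of
  \<open>i\<close> can still drop, with the smaller elements frozen, if each drop is as small as
  possible.\<close>

definition lower :: "nat \<Rightarrow> nat \<Rightarrow> nat list \<Rightarrow> nat set" where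
  "lower N i xs = {h. valid N i xs h \<and> lab N h < lab N (nxt xs i)}"

fun path_bound :: "nat \<Rightarrow> nat" where
  "path_bound 0 = 0"
| "path_bound (Suc m) = (Suc m - 7) * Suc (path_bound m)"

lemma valid_less: "valid N i xs h \<Longrightarrow> i < N \<Longrightarrow> h < N"
  using tours_nxt_less by (auto simp: valid_def)

lemma finite_lower: "i < N \<Longrightarrow> finite (lower N i xs)"
  by (rule finite_subset[of _ "{..<N}"]) (auto simp: lower_def valid_less)

text \<open>Dropping to the largest available label uses up a single element of
  \<open>lower\<close>, and the choice of the six largest labels for \<open>T\<close> refills level
  \<open>Suc i\<close>. Of the \<open>N - Suc i\<close> heads left over, six are at the top and at
  most one closes a short cycle, so at least \<open>N - Suc i - 7\<close> remain to drop to.\<close>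

lemma jump:
  assumes xs: "xs \<in> tours N" and i: "i + 7 < N" and ne: "lower N i xs \<noteq> {}"
  shows "\<exists>zs. step N xs zs \<and> agree i xs zs \<and> card (lower N i xs) \<le> Suc (card {h. valid N i xs h \<and> lab N h < lab N (nxt zs i)}) \<and>
     N - Suc i - 7 \<le> card (lower N (Suc i) zs)"
proof -
  have iN: "i < N" using i by simp
  note fin = finite_lower[OF iN, of xs]
  obtain h where h: "h \<in> lower N i xs" "\<forall>g\<in>lower N i xs. lab N g \<le> lab N h"
    using finite_has_max_value[OF fin ne] by blast
  have v: "valid N i xs h" and hl: "lab N h < lab N (nxt xs i)" using h(1) by (auto simp: lower_def)
  have hN: "h < N" using valid_less[OF v iN] .
  have h_unused: "h \<notin> nxt xs ` {..<i}"
  proof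
    assume "h \<in> nxt xs ` {..<i}"
    then obtain j where j: "j < i" "h = nxt xs j" by auto
    obtain ys where ys: "ys \<in> tours N" "agree i xs ys" "nxt ys i = h" using v by (auto simp: valid_def)
    then have "nxt ys j = nxt ys i" using j unfolding agree_def by metis
    then show False using j(1) tours_nxt_inj[OF ys(1), of j i] iN by simp
  qed
  define U where "U = {..<N} - nxt xs ` {..<i} - {h}"
  have "inj_on (nxt xs) {..<i}" using tours_nxt_inj[OF xs] iN by (auto simp: inj_on_def)
  then have "card (nxt xs ` {..<i}) = i" by (simp add: card_image)
  moreover have "nxt xs ` {..<i} \<subseteq> {..<N}" using tours_nxt_less[OF xs] iN by auto
  ultimately have cU: "card U = N - Suc i" using h_unused hN by (simp add: U_def card_Diff_subset)
  have fU: "finite U" and c6: "6 \<le> card U" using cU i by (simp_all add: U_def)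
  have inj: "inj_on (lab N) U" using lab_inj by (auto simp: U_def inj_on_def)
  then obtain T where T: "T \<subseteq> U" "card T = 6" "\<forall>t\<in>T. \<forall>u\<in>U - T. lab N u < lab N t"
    using exists_upper_subset[OF fU inj c6] by blast
  obtain zs where zs: "zs \<in> tours N" "adj xs zs" "agree i xs zs" "nxt zs i = h" "nxt zs (Suc i) \<in> T"
    using long_step[OF xs _ v _ T(1)[unfolded U_def]] T(2) hl i by force
  have "step N xs zs" using xs zs hl iN by (auto simp: step_def)
  moreover have "card (lower N i xs) \<le> Suc (card {g. valid N i xs g \<and> lab N g < lab N h})"
  proof -
    have fin': "finite {g. valid N i xs g \<and> lab N g < lab N h}"
      by (rule finite_subset[OF _ fin]) (use hl in \<open>auto simp: lower_def\<close>)
    have "lower N i xs \<subseteq> insert h {g. valid N i xs g \<and> lab N g < lab N h}"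
    proof
      fix g assume g: "g \<in> lower N i xs"
      then have "lab N g \<le> lab N h" "g < N" "valid N i xs g" using h(2) valid_less iN by (auto simp: lower_def)
      then show "g \<in> insert h {g. valid N i xs g \<and> lab N g < lab N h}" using lab_inj[of g N h] hN by auto
    qed
    then have "card (lower N i xs) \<le> card (insert h {g. valid N i xs g \<and> lab N g < lab N h})"
      using fin' by (intro card_mono) simp_all
    also have "\<dots> \<le> Suc (card {g. valid N i xs g \<and> lab N g < lab N h})"
      using fin' by (simp add: card_insert_if)
    finally show ?thesis .
  qed
  moreover have "N - Suc i - 7 \<le> card (lower N (Suc i) zs)"
  proof -
    let ?W = "{u. u < N \<and> lab N u < lab N (nxt zs (Suc i)) \<and> u \<notin> nxt zs ` {..Suc i}}"
    have "U - T \<subseteq> ?W"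
    proof
      fix u assume u: "u \<in> U - T"
      then have "lab N u < lab N (nxt zs (Suc i))" using T(3) zs(5) by blast
      moreover have "u \<notin> nxt zs ` {..Suc i}"
        using u zs(3,4,5) by (auto simp: U_def agree_def le_less less_Suc_eq)
      ultimately show "u \<in> ?W" using u by (auto simp: U_def)
    qed
    then have "card (U - T) \<le> card ?W" by (intro card_mono) auto
    moreover have "card (U - T) = N - Suc i - 6"
      using T(1,2) cU by (subst card_Diff_subset) (auto simp: U_def intro: finite_subset)
    ultimately show ?thesis using card_unused_le[OF zs(1), of "Suc i" "lab N (nxt zs (Suc i))"] i by (simp add: lower_def)
  qed
  ultimately show ?thesis using zs(3,4) by (intro exI[of _ zs]) simp
qed

text \<open>Between two drops at level \<open>i\<close> fits an entire descent at level
  \<open>Suc i\<close>. It keeps the successors of \<open>0, ..., i\<close>, so neither validity at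
  level \<open>i\<close> nor the current label changes, and the remaining drops stay
  available.\<close>

lemma long_descent:
  assumes "xs \<in> tours N" "i + m = N" "m - 7 \<le> card (lower N i xs)"
  shows "\<exists>L zs. path_bound m \<le> L \<and> (step N ^^ L) xs zs \<and> zs \<in> tours N \<and> agree i xs zs"
  using assms
proof (induction m arbitrary: i xs)
  case 0
  then show ?case using agree_refl by (intro exI[of _ 0] exI[of _ xs]) simp
next
  case (Suc m)
  show ?case
  proof (cases "Suc m \<le> 7")
    case True
    then have "path_bound (Suc m) = 0" by simp
    then show ?thesis using agree_refl Suc.prems(1) by (intro exI[of _ 0] exI[of _ xs]) simp
  next
    case False
    then have i: "i + 7 < N" using Suc.prems by simp
    note outer = Suc.IH
    note im = Suc.prems(2)
    have iter: "\<exists>L zs. r * Suc (path_bound m) \<le> L \<and> (step N ^^ L) xs zs \<and> zs \<in> tours N \<and> agree i xs zs"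
      if "xs \<in> tours N" "r \<le> card (lower N i xs)" for r xs
      using that
    proof (induction r arbitrary: xs)
      case 0
      then show ?case using agree_refl by (intro exI[of _ 0] exI[of _ xs]) simp
    next
      case (Suc r)
      then have "lower N i xs \<noteq> {}" by auto
      then obtain ys where ys: "step N xs ys" "agree i xs ys"
        "card (lower N i xs) \<le> Suc (card {h. valid N i xs h \<and> lab N h < lab N (nxt ys i)})"
        "N - Suc i - 7 \<le> card (lower N (Suc i) ys)"
        using jump[OF Suc.prems(1) i] by blast
      have "ys \<in> tours N" using ys(1) by (simp add: step_def)
      then obtain L1 ws where ws: "path_bound m \<le> L1" "(step N ^^ L1) ys ws" "ws \<in> tours N" "agree (Suc i) ys ws"
        using outer[of ys "Suc i"] ys(4) im by auto
      have "nxt ws i = nxt ys i" using ws(4) by (simp add: agree_def)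
      moreover have ag: "agree i xs ws" using ys(2) ws(4) by (auto simp: agree_def)
      ultimately have "r \<le> card (lower N i ws)"
        using ys(3) Suc.prems(2) valid_cong[OF ag] by (simp add: lower_def)
      then obtain L2 zs where zs: "r * Suc (path_bound m) \<le> L2" "(step N ^^ L2) ws zs" "zs \<in> tours N" "agree i ws zs"
        using Suc.IH[OF ws(3)] by blast
      have "(step N ^^ Suc (L1 + L2)) xs zs"
        using relpowp_Suc_I2[OF ys(1) relpowp_trans[OF ws(2) zs(2)]] .
      moreover have "Suc r * Suc (path_bound m) \<le> Suc (L1 + L2)" using ws(1) zs(1) by simp
      ultimately show ?case using zs(3) agree_trans[OF ag zs(4)] by blast
    qed
    show ?thesis using iter[OF Suc.prems(1,3)] by simp
  qed
qed

lemma nxt_upt: "i < N \<Longrightarrow> nxt [0..<N] i = Suc i mod N"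
  using nxt_nth[of "[0..<N]" i] by simp

lemma lab_Suc_mod: "i < N \<Longrightarrow> lab N (Suc i mod N) = i"
  by (auto simp: lab_def mod_Suc)

lemma upt_tours: "[0..<N] \<in> tours N"
  by (auto simp: tours_def)

text \<open>The list \<open>[0..<N]\<close> itself witnesses that its successor of \<open>i\<close>
  is valid. The labels below \<open>i\<close> already belong to smaller elements, so any other
  successor of \<open>i\<close> has a label above \<open>i\<close> and the exchange goes
  down.\<close>

lemma descent_to_upt:
  assumes "xs \<in> tours N" "agree i xs [0..<N]" "i + m = N"
  shows "\<exists>L zs. (step N ^^ L) xs zs \<and> zs \<in> tours N \<and> agree N zs [0..<N]"
  using assms
proof (induction m arbitrary: i xs)
  case 0
  then show ?case by (intro exI[of _ 0] exI[of _ xs]) simp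
next
  case (Suc m)
  then have i: "i < N" by simp
  have ag: "agree (Suc i) ys [0..<N]" if "agree i ys [0..<N]" "nxt ys i = nxt [0..<N] i" for ys
    using that by (auto simp: agree_def less_Suc_eq)
  show ?case
  proof (cases "nxt xs i = nxt [0..<N] i")
    case True
    then show ?thesis using Suc ag by auto
  next
    case False
    have v: "valid N i xs (nxt [0..<N] i)" unfolding valid_def using Suc.prems(2) upt_tours by blast
    obtain ys where ys: "ys \<in> tours N" "adj xs ys" "agree i xs ys" "nxt ys i = nxt [0..<N] i"
      using short_step[OF Suc.prems(1) i v] False by metis
    have "lab N (nxt xs i) \<noteq> j" if "j \<le> i" for j
    proof
      assume j: "lab N (nxt xs i) = j"
      have "lab N (nxt [0..<N] j) = j" using nxt_upt[of j N] lab_Suc_mod[of j N] that i by simp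
      then have "nxt xs i = nxt [0..<N] j"
        using j lab_inj tours_nxt_less[OF Suc.prems(1) i] tours_nxt_less[OF upt_tours] that i by (metis le_less_trans)
      moreover have "j < i" using calculation False that le_neq_implies_less by blast
      moreover from this have "nxt [0..<N] j = nxt xs j" using Suc.prems(2) by (simp add: agree_def)
      ultimately show False using tours_nxt_inj[OF Suc.prems(1), of i j] i by simp
    qed
    then have "i < lab N (nxt xs i)" using not_le by blast
    then have "step N xs ys" using Suc.prems(1) ys i nxt_upt[OF i] lab_Suc_mod[OF i] by (auto simp: step_def)
    moreover have "agree i ys [0..<N]" using agree_trans[OF agree_sym[OF ys(3)] Suc.prems(2)] .
    then obtain L zs where "(step N ^^ L) ys zs" "zs \<in> tours N" "agree N zs [0..<N]"
      using Suc.IH[OF ys(1) ag] ys(4) Suc.prems(3) by auto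
    ultimately show ?thesis using relpowp_Suc_I2 by metis
  qed
qed

lemma long_walk:
  assumes "3 \<le> N"
  shows "\<exists>L xs zs. path_bound N \<le> L \<and> (step N ^^ L) xs zs \<and> xs \<in> tours N \<and> zs \<in> tours N \<and> agree N zs [0..<N]"
proof -
  \<comment> \<open>The start gives the successor of \<open>0\<close> the largest possible label:
    only the head \<open>0\<close> has a larger one, and it would make \<open>0\<close> a fixed
    point. The \<open>N - 2\<close> heads from \<open>1\<close> to \<open>N - 2\<close> lie
    below.\<close>
  define xs where "xs = [0, N - 1] @ [1..<N - 1]"
  have xs: "xs \<in> tours N" using assms by (auto simp: xs_def tours_def)
  have n0: "nxt xs 0 = N - 1" using nxt_end[of "[]" 0 "(N - 1) # [1..<N - 1]"] assms by (simp add: xs_def)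
  have "{1..N - 2} \<subseteq> {h. h < N \<and> lab N h < lab N (nxt xs 0) \<and> h \<notin> nxt xs ` {..0}}"
    using assms n0 by (auto simp: lab_def)
  then have "card {1..N - 2} \<le> card {h. h < N \<and> lab N h < lab N (nxt xs 0) \<and> h \<notin> nxt xs ` {..0}}"
    by (intro card_mono) auto
  then have "N - 7 \<le> card (lower N 0 xs)"
    using card_unused_le[OF xs, of 0 "lab N (nxt xs 0)"] assms by (simp add: lower_def)
  then obtain L1 ys where ys: "path_bound N \<le> L1" "(step N ^^ L1) xs ys" "ys \<in> tours N"
    using long_descent[OF xs, of 0 N] by auto
  obtain L2 zs where zs: "(step N ^^ L2) ys zs" "zs \<in> tours N" "agree N zs [0..<N]"
    using descent_to_upt[OF ys(3), of 0 N] by (auto simp: agree_def)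
  show ?thesis using ys zs xs relpowp_trans[OF ys(2) zs(1)] by (metis trans_le_add1)
qed

text \<open>The comparison starts at 8 because \<open>path_bound 7 = 0\<close>, whereas the
  factorial of 0 is 1.\<close>

lemma fact_le_path_bound: "8 \<le> m \<Longrightarrow> fact (m - 7) \<le> path_bound m"
proof (induction m rule: nat_induct_at_least)
  case base
  then show ?case by (simp add: numeral_eq_Suc)
next
  case (Suc m)
  have "Suc m - 7 = Suc (m - 7)" using Suc.hyps by simp
  moreover have "Suc (m - 7) * fact (m - 7) \<le> Suc (m - 7) * Suc (path_bound m)"
    using Suc.IH by (intro mult_le_mono) auto
  ultimately show ?case by (simp only: fact_Suc path_bound.simps of_nat_id)
qed

section \<open>Embedding into the complete graph\<close>

definition cycle_edges :: "'a list \<Rightarrow> 'a set set" where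
  "cycle_edges ys = (\<lambda>a. {a, nxt ys a}) ` set ys"

text \<open>Two different arcs over the same edge would be opposite to each other and form a cycle
  of length two.\<close>

lemma inj_on_cycle_edge:
  assumes "distinct ys" "3 \<le> length ys"
  shows "inj_on (\<lambda>a. {a, nxt ys a}) (set ys)"
proof (rule inj_onI)
  fix a b assume ab: "a \<in> set ys" "b \<in> set ys" "{a, nxt ys a} = {b, nxt ys b}"
  then show "a = b" using nxt_nxt_neq[OF assms ab(1)] by (auto simp: doubleton_eq_iff)
qed

lemma tour_cycle_edges:
  assumes "distinct ys" "set ys = {..<n}" "3 \<le> n"
  shows "tour n (cycle_edges ys)"
proof -
  have len: "length ys = n" using distinct_card[OF assms(1)] assms(2) by simp
  have "cycle_edges ys = {{ys ! i, ys ! (Suc i mod n)} | i. i < n}"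
    unfolding cycle_edges_def using len nxt_nth[OF assms(1)] by (auto simp: set_conv_nth[of ys] image_def)
  then show ?thesis using assms by (auto simp: tour_def)
qed

lemma tour_imp_cycle_edges:
  assumes "tour n M"
  obtains ys where "distinct ys" "set ys = {..<n}" "3 \<le> n" "M = cycle_edges ys"
proof -
  obtain ys where ys: "distinct ys" "set ys = {..<n}" "3 \<le> n" "M = {{ys ! i, ys ! (Suc i mod n)} | i. i < n}"
    using assms by (auto simp: tour_def)
  have len: "length ys = n" using distinct_card[OF ys(1)] ys(2) by simp
  have "cycle_edges ys = M"
    unfolding cycle_edges_def using len nxt_nth[OF ys(1)] ys(4) by (auto simp: set_conv_nth[of ys] image_def)
  then show ?thesis using that ys by blast
qed

lemma cycle_edges_at:
  assumes "distinct ys" "v \<in> set ys" "w \<in> set ys" "nxt ys w = v"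
  shows "{e \<in> cycle_edges ys. v \<in> e} = {{v, nxt ys v}, {w, v}}"
  using assms inj_on_nxt[OF assms(1)] by (auto simp: cycle_edges_def inj_on_def)

lemma cycle_edges_perfect:
  assumes "distinct ys" "set ys = {..<n}" "3 \<le> n"
  shows "perfect_2_matching n (cycle_edges ys)"
proof -
  have len: "length ys = n" using distinct_card[OF assms(1)] assms(2) by simp
  have "cycle_edges ys \<subseteq> complete_edges n"
  proof
    fix e assume "e \<in> cycle_edges ys"
    then obtain a where a: "a \<in> set ys" "e = {a, nxt ys a}" by (auto simp: cycle_edges_def)
    then have "nxt ys a \<in> set ys" "nxt ys a \<noteq> a"
      using nxt_in_set[OF assms(1) a(1)] nxt_neq[OF assms(1) _ a(1)] assms(3) len by auto
    then show "e \<in> complete_edges n" using a assms(2) unfolding complete_edges_def by blast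
  qed
  moreover have "card {e \<in> cycle_edges ys. v \<in> e} = 2" if "v < n" for v
  proof -
    have v: "v \<in> set ys" using that assms by simp
    then obtain w where w: "w \<in> set ys" "nxt ys w = v" using nxt_image[OF assms(1)] by (metis imageE)
    have "nxt ys v \<noteq> w" using nxt_nxt_neq[OF assms(1), of w] w len assms(3) by auto
    moreover have "w \<noteq> v" using nxt_neq[OF assms(1), of w] w len assms(3) by auto
    ultimately show ?thesis using cycle_edges_at[OF assms(1) v w] by (simp add: doubleton_eq_iff)
  qed
  ultimately show ?thesis by (simp add: perfect_2_matching_def)
qed

lemma tour_perfect: "tour n M \<Longrightarrow> perfect_2_matching n M"
  by (metis tour_imp_cycle_edges cycle_edges_perfect)

section \<open>Perfect 2-matchings between two tours\<close>

lemma finite_complete_edges: "finite (complete_edges n)"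
  by (rule finite_subset[of _ "Pow {..<n}"]) (auto simp: complete_edges_def)

lemma perfect_subset: "{M. perfect_2_matching n M} \<subseteq> Pow (complete_edges n)"
  by (auto simp: perfect_2_matching_def)

text \<open>The form in which degree two is used at a vertex where two tours share one edge and
  differ in the other.\<close>

lemma exactly_one_edge:
  assumes "perfect_2_matching n S" "v < n" "{e \<in> S. v \<in> e} \<subseteq> {f, g, h}" "f \<in> S" "v \<in> f" "v \<in> g" "v \<in> h"
    "f \<noteq> g" "f \<noteq> h" "g \<noteq> h"
  shows "g \<in> S \<longleftrightarrow> h \<notin> S"
proof -
  have c: "card {e \<in> S. v \<in> e} = 2" using assms(1,2) by (simp add: perfect_2_matching_def)
  show ?thesis
  proof
    assume "g \<in> S"
    then show "h \<notin> S"
    proof (intro notI)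
      assume "h \<in> S"
      then have "{e \<in> S. v \<in> e} = {f, g, h}" using \<open>g \<in> S\<close> assms by blast
      then show False using c assms by simp
    qed
  next
    assume "h \<notin> S"
    show "g \<in> S"
    proof (rule ccontr)
      assume "g \<notin> S"
      then have "{e \<in> S. v \<in> e} = {f}" using \<open>h \<notin> S\<close> assms by blast
      then show False using c by simp
    qed
  qed
qed

text \<open>By \<open>D\<close>, where an arc changes, the arcs leaving its old and its new head do
  not. So every affected vertex carries one common, one old and one new edge, and its degree makes
  \<open>S\<close> choose between the last two. The choices at tails and heads propagate along the
  orbit of changed arcs; as there is only one orbit, \<open>S\<close> is one of the two
  tours.\<close>

lemma adj_imp_between:
  assumes d: "distinct ys" "distinct ys'" and set: "set ys = {..<n}" "set ys' = {..<n}" and n: "3 \<le> n"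
    and adj: "adj ys ys'"
    and D: "\<And>a. a < n \<Longrightarrow> nxt ys' a \<noteq> nxt ys a \<Longrightarrow> nxt ys' (nxt ys a) = nxt ys (nxt ys a) \<and> nxt ys' (nxt ys' a) = nxt ys (nxt ys' a)"
    and S: "perfect_2_matching n S" "cycle_edges ys \<inter> cycle_edges ys' \<subseteq> S" "S \<subseteq> cycle_edges ys \<union> cycle_edges ys'"
  shows "S = cycle_edges ys \<or> S = cycle_edges ys'"
proof -
  have len: "length ys = n" "length ys' = n" using distinct_card[OF d(1)] distinct_card[OF d(2)] set by simp_all
  have in1: "a < n \<Longrightarrow> nxt ys a < n" and in2: "a < n \<Longrightarrow> nxt ys' a < n" for a
    using nxt_in_set[OF d(1), of a] nxt_in_set[OF d(2), of a] set by auto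
  have ex1: "\<exists>w<n. nxt ys w = v" if "v < n" for v
    using nxt_image[OF d(1)] that set by (metis imageE lessThan_iff)
  have inj1: "nxt ys a = nxt ys b \<Longrightarrow> a = b" and inj2: "nxt ys' a = nxt ys' b \<Longrightarrow> a = b" if "a < n" "b < n" for a b
    using inj_on_nxt[OF d(1)] inj_on_nxt[OF d(2)] that set by (auto simp: inj_on_def)
  have ne1: "nxt ys a \<noteq> a" "nxt ys (nxt ys a) \<noteq> a" if "a < n" for a
    using nxt_neq[OF d(1), of a] nxt_nxt_neq[OF d(1), of a] that len set n by auto
  have ne2: "nxt ys' a \<noteq> a" "nxt ys' (nxt ys' a) \<noteq> a" if "a < n" for a
    using nxt_neq[OF d(2), of a] nxt_nxt_neq[OF d(2), of a] that len set n by auto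
  have e1: "{a, nxt ys a} \<in> cycle_edges ys" and e2: "{a, nxt ys' a} \<in> cycle_edges ys'" if "a < n" for a
    using that set by (auto simp: cycle_edges_def)
  have at: "{e \<in> S. v \<in> e} \<subseteq> {{v, nxt ys v}, {w, v}} \<union> {{v, nxt ys' v}, {w', v}}"
    if "v < n" "w < n" "w' < n" "nxt ys w = v" "nxt ys' w' = v" for v w w'
  proof -
    have "{e \<in> S. v \<in> e} \<subseteq> {e \<in> cycle_edges ys. v \<in> e} \<union> {e \<in> cycle_edges ys'. v \<in> e}"
      using S(3) by blast
    then show ?thesis
      using cycle_edges_at[OF d(1), of v w] cycle_edges_at[OF d(2), of v w'] that set by simp
  qed
  have tail: "{a, nxt ys a} \<in> S \<longleftrightarrow> {a, nxt ys' a} \<notin> S" if a: "a < n" "nxt ys' a \<noteq> nxt ys a" for a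
  proof -
    obtain w where w: "w < n" "nxt ys w = a" using ex1 a by blast
    \<comment> \<open>The arc into the tail \<open>a\<close> is common: if it changed at
      \<open>w\<close>, then \<open>D\<close> would forbid a change at its head
      \<open>a\<close>.\<close>
    have w': "nxt ys' w = a" using D[OF w(1)] w(2) a(2) by metis
    show ?thesis
    proof (rule exactly_one_edge[OF S(1) a(1)])
      show "{e \<in> S. a \<in> e} \<subseteq> {{w, a}, {a, nxt ys a}, {a, nxt ys' a}}"
        using at[OF a(1) w(1) w(1) w(2) w'] by auto
      show "{w, a} \<in> S" using e1[OF w(1)] e2[OF w(1)] w w' S(2) by auto
      show "{w, a} \<noteq> {a, nxt ys a}" "{w, a} \<noteq> {a, nxt ys' a}" "{a, nxt ys a} \<noteq> {a, nxt ys' a}"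
        using ne1[OF w(1)] ne2[OF w(1)] w(2) w' a(2) by (auto simp: doubleton_eq_iff)
    qed auto
  qed
  have head: "{a, nxt ys' a} \<notin> S \<longleftrightarrow> {b, nxt ys b} \<in> S"
    if a: "a < n" "nxt ys' a \<noteq> nxt ys a" and b: "b < n" "nxt ys b = nxt ys' a" for a b
  proof -
    let ?v = "nxt ys' a"
    have v: "?v < n" "nxt ys' ?v = nxt ys ?v" using in2 a D by auto
    have "{b, ?v} \<in> S \<longleftrightarrow> {a, ?v} \<notin> S"
    proof (rule exactly_one_edge[OF S(1) v(1)])
      show "{e \<in> S. ?v \<in> e} \<subseteq> {{?v, nxt ys ?v}, {b, ?v}, {a, ?v}}"
        using at[OF v(1) b(1) a(1) b(2) refl] v(2) by auto
      show "{?v, nxt ys ?v} \<in> S" using e1[OF v(1)] e2[OF v(1)] v S(2) by auto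
      show "{?v, nxt ys ?v} \<noteq> {b, ?v}" using ne1(2)[OF b(1)] ne1(1)[OF b(1)] b(2) by (auto simp: doubleton_eq_iff)
      show "{?v, nxt ys ?v} \<noteq> {a, ?v}" using ne2[OF a(1)] v(2) by (auto simp: doubleton_eq_iff)
      show "{b, ?v} \<noteq> {a, ?v}" using a b by (auto simp: doubleton_eq_iff)
    qed auto
    then show ?thesis using b(2) by simp
  qed
  have const: "{a, nxt ys a} \<in> S \<longleftrightarrow> {b, nxt ys b} \<in> S"
    if "a < n" "nxt ys' a \<noteq> nxt ys a" "b < n" "nxt ys' b \<noteq> nxt ys b" for a b
  proof -
    have "\<forall>a\<in>set ys. \<forall>b\<in>set ys. nxt ys' a \<noteq> nxt ys a \<longrightarrow> nxt ys' a = nxt ys b \<longrightarrow>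
      ({a, nxt ys a} \<in> S) = ({b, nxt ys b} \<in> S)"
    proof (intro ballI impI)
      fix a b assume "a \<in> set ys" "b \<in> set ys" and ne: "nxt ys' a \<noteq> nxt ys a" and eq: "nxt ys' a = nxt ys b"
      then have "a < n" "b < n" using set by auto
      then show "({a, nxt ys a} \<in> S) = ({b, nxt ys b} \<in> S)" using tail[OF _ ne] head[OF _ ne _ eq[symmetric]] by blast
    qed
    note const = adj[unfolded adj_def, THEN spec, of "\<lambda>a. {a, nxt ys a} \<in> S", THEN mp, OF this, rule_format]
    show ?thesis by (rule const) (use that set in simp_all)
  qed
  have common: "{a, nxt ys a} \<in> S" if "a < n" "nxt ys' a = nxt ys a" for a
  proof -
    have "{a, nxt ys a} \<in> cycle_edges ys'" using e2[OF that(1)] that(2) by simp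
    then show ?thesis using e1[OF that(1)] S(2) by blast
  qed
  have fromS: "\<exists>a<n. e = {a, nxt ys a} \<or> e = {a, nxt ys' a}" if "e \<in> S" for e
  proof -
    have "e \<in> cycle_edges ys \<or> e \<in> cycle_edges ys'" using that S(3) by blast
    then show ?thesis using set by (auto simp: cycle_edges_def)
  qed
  show ?thesis
  proof (cases "\<exists>a<n. nxt ys' a \<noteq> nxt ys a \<and> {a, nxt ys a} \<notin> S")
    case False
    then have all: "{a, nxt ys a} \<in> S" if "a < n" for a using common that by blast
    have "S \<subseteq> cycle_edges ys"
    proof
      fix e assume e: "e \<in> S"
      then obtain a where a: "a < n" "e = {a, nxt ys a} \<or> e = {a, nxt ys' a}" using fromS by blast
      then show "e \<in> cycle_edges ys" using tail[OF a(1)] all[OF a(1)] e e1[OF a(1)] by metis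
    qed
    moreover have "cycle_edges ys \<subseteq> S" using all set by (auto simp: cycle_edges_def)
    ultimately show ?thesis by blast
  next
    case True
    then have none: "{a, nxt ys a} \<notin> S" if "a < n" "nxt ys' a \<noteq> nxt ys a" for a using const that by blast
    then have all: "{a, nxt ys' a} \<in> S" if "a < n" for a using common[of a] tail[of a] that by metis
    have "S \<subseteq> cycle_edges ys'"
    proof
      fix e assume e: "e \<in> S"
      then obtain a where a: "a < n" "e = {a, nxt ys a} \<or> e = {a, nxt ys' a}" using fromS by blast
      then show "e \<in> cycle_edges ys'" using none[OF a(1)] e e2[OF a(1)] by metis
    qed
    moreover have "cycle_edges ys' \<subseteq> S" using all set by (auto simp: cycle_edges_def)
    ultimately show ?thesis by blast
  qed
qed

section \<open>Replacing nodes by paths\<close>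

lemma nxt_map:
  assumes "inj_on f (set xs)" "a \<in> set xs"
  shows "nxt (map f xs) (f a) = f (nxt xs a)"
proof -
  obtain P Q where xs: "xs = P @ a # Q" "a \<notin> set P" using assms(2) by (meson split_list_first)
  have "f a \<notin> f ` set P" using assms(1) xs by (auto simp: inj_on_def)
  then have "nxt (map f xs) (f a) = hd (map f (Q @ P @ [a]))"
    using nxt_split[of "f a" "map f P" "map f Q"] xs by simp
  then show ?thesis using nxt_split[OF xs(2), of Q] xs by (cases Q; cases P) auto
qed

text \<open>
  Node \<open>0\<close> starts at \<open>2 N - 1\<close>, the last odd vertex below \<open>2 N\<close>, and for odd \<open>n\<close> passes through the
  remaining vertex \<open>2 N\<close>.
\<close>

definition node_path :: "nat \<Rightarrow> nat \<Rightarrow> nat list" where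
  "node_path n i = (if i = 0 then [2 * (n div 2) - 1..<n] @ [0] else [2 * i - 1, 2 * i])"

definition expand :: "nat \<Rightarrow> nat list \<Rightarrow> nat list" where
  "expand n xs = concat (map (node_path n) xs)"

context
  fixes n N :: nat
  assumes N: "N = n div 2" "2 \<le> N"
begin

lemma n_cases: "n = 2 * N \<or> n = 2 * N + 1"
  using N by presburger

text \<open>The conditional is the inverse of \<open>node_path\<close>: vertices
  \<open>2 * i - 1\<close> and \<open>2 * i\<close> belong to node \<open>i\<close>, and all
  vertices from \<open>2 * N - 1\<close> on belong to node \<open>0\<close>.\<close>

lemma mem_node_path:
  assumes "i < N" shows "k \<in> set (node_path n i) \<longleftrightarrow> k < n \<and> (if 2 * N \<le> Suc k then 0 else Suc k div 2) = i"
  using assms N by (auto simp: node_path_def)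

lemma node_path_upper: "node_path n 0 = (if n = 2 * N then [2 * N - 1, 0] else [2 * N - 1, 2 * N, 0])"
proof -
  have "[2 * N - 1..<n] = (if n = 2 * N then [2 * N - 1] else [2 * N - 1, 2 * N])"
    using n_cases N(2) by (auto simp: upt_rec)
  then show ?thesis by (simp add: node_path_def N(1)[symmetric])
qed

lemma inj_node_path: "inj_on (node_path n) {..<N}"
proof (rule inj_onI)
  fix i j assume ij: "i \<in> {..<N}" "j \<in> {..<N}" "node_path n i = node_path n j"
  have "2 * i \<in> set (node_path n i)" by (simp add: node_path_def)
  then show "i = j" using ij mem_node_path[of i "2 * i"] mem_node_path[of j "2 * i"] by simp
qed

lemma expand_tour:
  assumes "xs \<in> tours N"
  shows "distinct (expand n xs)" "set (expand n xs) = {..<n}"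
proof -
  have xs: "distinct xs" "set xs = {..<N}" using assms by (auto simp: tours_def)
  show "distinct (expand n xs)" unfolding expand_def
  proof (rule distinct_concat)
    show "distinct (map (node_path n) xs)" using xs inj_node_path by (simp add: distinct_map)
    show "distinct S" if "S \<in> set (map (node_path n) xs)" for S
      using that N(2) node_path_upper by (auto simp: node_path_def)
    show "set S \<inter> set T = {}" if ST: "S \<in> set (map (node_path n) xs)" "T \<in> set (map (node_path n) xs)" "S \<noteq> T" for S T
    proof -
      obtain i j where "i < N" "j < N" "S = node_path n i" "T = node_path n j" using ST xs by auto
      then show ?thesis using ST(3) mem_node_path[of i] mem_node_path[of j] by fastforce
    qed
  qed
  have "k \<in> set (expand n xs) \<longleftrightarrow> k < n" for k
  proof -
    have "(if 2 * N \<le> Suc k then 0 else Suc k div 2) < N" using N(2) by auto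
    then show ?thesis using xs mem_node_path by (auto simp: expand_def)
  qed
  then show "set (expand n xs) = {..<n}" by blast
qed

text \<open>Labels are made so that the path of node \<open>j\<close> starts at
  \<open>2 * lab N j + 1\<close>. The even vertices below \<open>2 * N\<close> are the path ends and
  carry the variable arcs; all others follow the numbering, including, for odd \<open>n\<close>, the
  vertex \<open>2 * N\<close>, which returns to \<open>0\<close>.\<close>

lemma nxt_expand:
  assumes xs: "xs \<in> tours N" and a: "a < n"
  shows "nxt (expand n xs) a = (if even a \<and> a < 2 * N then 2 * lab N (nxt xs (a div 2)) + 1 else Suc a mod n)"
proof -
  have xs': "distinct xs" "set xs = {..<N}" using xs by (auto simp: tours_def)
  define i where "i = (if 2 * N \<le> Suc a then 0 else Suc a div 2)"
  have i: "i < N" using N(2) by (auto simp: i_def)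
  then have mem: "a \<in> set (node_path n i)" using mem_node_path a by (simp add: i_def)
  have last: "last (node_path n i) = 2 * i" by (simp add: node_path_def)
  have hd: "hd (node_path n j) = 2 * lab N j + 1" if "j < N" for j
    using that N n_cases by (auto simp: node_path_def lab_def hd_append)
  have ij: "nxt xs i < N" using tours_nxt_less[OF xs i] .
  have "nxt (expand n xs) a = (if a = 2 * i then hd (nxt (map (node_path n) xs) (node_path n i)) else nxt (node_path n i) a)"
    unfolding expand_def last[symmetric]
    by (rule nxt_concat) (use expand_tour(1)[OF xs] mem xs' i in \<open>auto simp: expand_def node_path_def\<close>)
  also have "nxt (map (node_path n) xs) (node_path n i) = node_path n (nxt xs i)"
    using nxt_map[of "node_path n" xs i] inj_node_path xs' i by simp
  also have "hd (node_path n (nxt xs i)) = 2 * lab N (nxt xs i) + 1" using hd[OF ij] .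
  also have "nxt (node_path n i) a = Suc a mod n" if "a \<noteq> 2 * i"
  proof (cases "i = 0")
    case True
    then show ?thesis using mem that n_cases N(2) by (auto simp: node_path_upper nxt_def)
  next
    case False
    then have "a = 2 * i - 1" "Suc a < n" using mem that i n_cases by (auto simp: node_path_def)
    then show ?thesis using False by (simp add: node_path_def nxt_def)
  qed
  moreover have "a = 2 * i \<longleftrightarrow> even a \<and> a < 2 * N" "even a \<and> a < 2 * N \<longrightarrow> a div 2 = i"
    using a i mem n_cases by (auto simp: i_def split: if_splits; presburger)+
  ultimately show ?thesis by simp
qed

end

section \<open>The objective and its optimum\<close>

text \<open>The entries of \<open>t\<close> act as digits in base \<open>N\<close>: those behind
  position \<open>i\<close> add up to less than one unit of the weight at \<open>i\<close>.\<close>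

lemma lex_sum_less:
  fixes s t :: "nat \<Rightarrow> nat"
  assumes i: "i < N" and eq: "\<And>j. j < i \<Longrightarrow> t j = s j" and less: "t i < s i" and bound: "\<And>j. j < N \<Longrightarrow> t j < N"
  shows "(\<Sum>j<N. t j * N ^ (N - j)) < (\<Sum>j<N. s j * N ^ (N - j))"
proof -
  \<comment> \<open>The last weight is \<open>N ^ 1\<close>, not \<open>N ^ 0\<close>, hence the
    exponent \<open>Suc d\<close> for the last \<open>d\<close> terms.\<close>
  have tail: "(\<Sum>j\<in>{N - d..<N}. t j * N ^ (N - j)) < N ^ Suc d" if "d \<le> N" for d
    using that
  proof (induction d)
    case 0
    then show ?case using i by simp
  next
    case (Suc d)
    have "{N - Suc d..<N} = insert (N - Suc d) {N - d..<N}" using Suc.prems by auto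
    then have "(\<Sum>j\<in>{N - Suc d..<N}. t j * N ^ (N - j)) = t (N - Suc d) * N ^ Suc d + (\<Sum>j\<in>{N - d..<N}. t j * N ^ (N - j))"
      using Suc.prems by simp
    also have "\<dots> < t (N - Suc d) * N ^ Suc d + N ^ Suc d" using Suc by simp
    also have "\<dots> = Suc (t (N - Suc d)) * N ^ Suc d" by simp
    also have "\<dots> \<le> N * N ^ Suc d" using bound[of "N - Suc d"] i by (intro mult_le_mono1) (simp add: Suc_leI)
    finally show ?case by simp
  qed
  have split: "(\<Sum>j<N. f j) = (\<Sum>j<i. f j) + f i + (\<Sum>j\<in>{Suc i..<N}. f j)" for f :: "nat \<Rightarrow> nat"
  proof -
    have "{..<N} = {..<i} \<union> insert i {Suc i..<N}" using i by auto
    moreover have "{..<i} \<inter> insert i {Suc i..<N} = {}" by auto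
    ultimately show ?thesis by (simp add: sum.union_disjoint del: Un_insert_right)
  qed
  have "(\<Sum>j\<in>{Suc i..<N}. t j * N ^ (N - j)) < N ^ (N - i)"
    using tail[of "N - Suc i"] i by (simp add: Suc_diff_Suc)
  then have "t i * N ^ (N - i) + (\<Sum>j\<in>{Suc i..<N}. t j * N ^ (N - j)) < Suc (t i) * N ^ (N - i)" by simp
  also have "\<dots> \<le> s i * N ^ (N - i)" using less by (intro mult_le_mono1) simp
  finally show ?thesis unfolding split using eq by simp
qed

text \<open>The edge from the end of the path of node \<open>i\<close> to the start of the path with
  label \<open>j\<close>. Parity tells the two endpoints apart, so the direction survives in the
  undirected edge.\<close>

definition arc_edge :: "nat \<Rightarrow> nat \<Rightarrow> nat set" where
  "arc_edge i j = {2 * i, 2 * j + 1}"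

lemma arc_mem: "2 * k \<in> arc_edge i j \<longleftrightarrow> k = i" "2 * k + 1 \<in> arc_edge i j \<longleftrightarrow> k = j" "Suc (2 * k) \<in> arc_edge i j \<longleftrightarrow> k = j"
  by (auto simp: arc_edge_def) presburger+

lemma arc_inject: "arc_edge i j = arc_edge i' j' \<longleftrightarrow> i = i' \<and> j = j'"
  by (metis arc_mem(1,2))

text \<open>The inner edges of the node paths, contained in every expanded tour.\<close>

definition fixed_edges :: "nat \<Rightarrow> nat set set" where
  "fixed_edges n = (\<lambda>k. {k, Suc k mod n}) ` {k. k < n \<and> \<not> (even k \<and> k < 2 * (n div 2))}"

text \<open>The objective is a function of undirected edges, so tail and head label are recovered
  from \<open>e\<close> by parity.\<close>

definition arc_cost :: "nat \<Rightarrow> nat set \<Rightarrow> nat" where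
  "arc_cost N e = the_elem {j. 2 * j + 1 \<in> e} * N ^ (N - the_elem {i. 2 * i \<in> e})"

lemma arc_cost_arc: "arc_cost N (arc_edge i j) = j * N ^ (N - i)"
  by (simp add: arc_cost_def arc_mem)

text \<open>One more than the cost of the arcs of \<open>[0..<N]\<close>. This outweighs any saving
  below that tour, so that omitting an inner edge or using a foreign edge never pays.\<close>

definition big_cost :: "nat \<Rightarrow> int" where
  "big_cost N = int (Suc (\<Sum>i<N. i * N ^ (N - i)))"

lemma big_cost_pos: "0 < big_cost N"
  by (simp only: big_cost_def of_nat_0_less_iff zero_less_Suc)

definition edge_cost :: "nat \<Rightarrow> nat set \<Rightarrow> int" where
  "edge_cost n e = (let N = n div 2 in
     if e \<in> fixed_edges n then - big_cost N
     else if \<exists>i<N. \<exists>j<N. e = arc_edge i j then int (arc_cost N e) else big_cost N)"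

context
  fixes n N :: nat
  assumes N: "N = n div 2" "2 \<le> N"
begin

lemma length_expand:
  assumes "xs \<in> tours N" shows "length (expand n xs) = n"
  using distinct_card[OF expand_tour(1)[OF N assms]] expand_tour(2)[OF N assms] by simp

lemma cycle_edges_expand:
  assumes xs: "xs \<in> tours N"
  defines "A \<equiv> (\<lambda>i. arc_edge i (lab N (nxt xs i))) ` {..<N}"
  shows "cycle_edges (expand n xs) = fixed_edges n \<union> A" "fixed_edges n \<inter> A = {}"
proof -
  let ?ys = "expand n xs" and ?K = "{k. k < n \<and> \<not> (even k \<and> k < 2 * N)}"
  note set = expand_tour(2)[OF N xs]
  have inj: "inj_on (\<lambda>a. {a, nxt ?ys a}) {..<n}"
    using inj_on_cycle_edge[OF expand_tour(1)[OF N xs]] length_expand[OF xs] set N by simp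
  have F: "fixed_edges n = (\<lambda>a. {a, nxt ?ys a}) ` ?K"
    unfolding fixed_edges_def N(1)[symmetric] by (intro image_cong refl) (auto simp: nxt_expand[OF N xs])
  have A: "A = (\<lambda>a. {a, nxt ?ys a}) ` ((*) 2 ` {..<N})"
    unfolding A_def image_image using N(1) by (intro image_cong refl) (auto simp: nxt_expand[OF N xs] arc_edge_def)
  have U: "{..<n} = ?K \<union> (*) 2 ` {..<N}" "?K \<inter> (*) 2 ` {..<N} = {}"
    using N(1) by (auto simp: image_iff elim!: evenE)
  show "cycle_edges ?ys = fixed_edges n \<union> A"
    unfolding F A cycle_edges_def set U(1) by (rule image_Un)
  show "fixed_edges n \<inter> A = {}"
    unfolding F A using inj_on_image_Int[OF inj, of ?K "(*) 2 ` {..<N}"] U by auto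
qed

lemma finite_fixed: "finite (fixed_edges n)"
  by (simp add: fixed_edges_def)

lemma sum_edge_cost_arcs:
  assumes "\<And>i. i < N \<Longrightarrow> s i < N" "fixed_edges n \<inter> (\<lambda>i. arc_edge i (s i)) ` {..<N} = {}"
  shows "sum (edge_cost n) ((\<lambda>i. arc_edge i (s i)) ` {..<N}) = int (\<Sum>i<N. s i * N ^ (N - i))"
proof -
  have "edge_cost n (arc_edge i (s i)) = int (s i * N ^ (N - i))" if "i < N" for i
  proof -
    have "arc_edge i (s i) \<notin> fixed_edges n" using assms(2) that by auto
    moreover have "\<exists>i'<N. \<exists>j<N. arc_edge i (s i) = arc_edge i' j" using that assms(1) by blast
    ultimately show ?thesis unfolding edge_cost_def Let_def N(1)[symmetric] arc_cost_arc by simp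
  qed
  moreover have "inj_on (\<lambda>i. arc_edge i (s i)) {..<N}" by (auto simp: inj_on_def arc_inject)
  ultimately show ?thesis by (simp add: sum.reindex)
qed

lemma sum_edge_cost_fixed: "sum (edge_cost n) (fixed_edges n) = - int (card (fixed_edges n)) * big_cost N"
proof -
  have "sum (edge_cost n) (fixed_edges n) = (\<Sum>e\<in>fixed_edges n. - big_cost N)"
    by (intro sum.cong refl) (simp only: edge_cost_def Let_def N(1)[symmetric] if_True)
  then show ?thesis by simp
qed

lemma sum_edge_cost_expand:
  assumes xs: "xs \<in> tours N"
  shows "sum (edge_cost n) (cycle_edges (expand n xs)) =
    sum (edge_cost n) (fixed_edges n) + int (\<Sum>i<N. lab N (nxt xs i) * N ^ (N - i))"
proof -
  have "lab N (nxt xs i) < N" if "i < N" for i using lab_less tours_nxt_less[OF xs that] .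
  then show ?thesis
    using cycle_edges_expand[OF xs] sum_edge_cost_arcs finite_fixed by (simp add: sum.union_disjoint)
qed

text \<open>Changed arcs run from even path ends to odd path starts, and the arc after such a start
  is an inner one, common to both tours; this is the condition on heads in
  \<open>adj_imp_between\<close>. The orbit of changed arcs is that of the permutations with every
  element doubled.\<close>

lemma step_imp_edge:
  assumes "step N xs zs"
  shows "sum (edge_cost n) (cycle_edges (expand n zs)) < sum (edge_cost n) (cycle_edges (expand n xs))"
    and "perfect_2_matching n S \<Longrightarrow> cycle_edges (expand n xs) \<inter> cycle_edges (expand n zs) \<subseteq> S \<Longrightarrow>
      S \<subseteq> cycle_edges (expand n xs) \<union> cycle_edges (expand n zs) \<Longrightarrow>
      S = cycle_edges (expand n xs) \<or> S = cycle_edges (expand n zs)"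
proof -
  obtain i where xs: "xs \<in> tours N" and zs: "zs \<in> tours N" and adj: "adj xs zs"
    and i: "i < N" "agree i xs zs" "lab N (nxt zs i) < lab N (nxt xs i)"
    using assms by (auto simp: step_def)
  have "(\<Sum>j<N. lab N (nxt zs j) * N ^ (N - j)) < (\<Sum>j<N. lab N (nxt xs j) * N ^ (N - j))"
    using i lab_less tours_nxt_less[OF zs] by (intro lex_sum_less[OF i(1)]) (auto simp: agree_def)
  then show "sum (edge_cost n) (cycle_edges (expand n zs)) < sum (edge_cost n) (cycle_edges (expand n xs))"
    unfolding sum_edge_cost_expand[OF xs] sum_edge_cost_expand[OF zs] by linarith
  note ex = nxt_expand[OF N xs] and ez = nxt_expand[OF N zs]
  note setx = expand_tour[OF N xs] and setz = expand_tour[OF N zs]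
  have changed: "\<exists>i<N. a = 2 * i \<and> nxt zs i \<noteq> nxt xs i" if "a < n" "nxt (expand n zs) a \<noteq> nxt (expand n xs) a" for a
    using that ex ez by (intro exI[of _ "a div 2"]) (auto split: if_splits)
  have lab_eq: "lab N (nxt us a) = lab N (nxt vs b) \<longleftrightarrow> nxt us a = nxt vs b"
    if "us \<in> tours N" "vs \<in> tours N" "a < N" "b < N" for us vs a b
    using lab_inj tours_nxt_less that by blast
  have less: "2 * a < n" if "a < N" for a using that N by linarith
  have adj': "adj (expand n xs) (expand n zs)"
    unfolding adj_def
  proof (intro allI impI ballI)
    fix P a b
    assume P: "\<forall>a\<in>set (expand n xs). \<forall>b\<in>set (expand n xs). nxt (expand n zs) a \<noteq> nxt (expand n xs) a \<longrightarrow>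
        nxt (expand n zs) a = nxt (expand n xs) b \<longrightarrow> P a = (P b :: bool)"
      and ab: "a \<in> set (expand n xs)" "b \<in> set (expand n xs)"
      "nxt (expand n zs) a \<noteq> nxt (expand n xs) a" "nxt (expand n zs) b \<noteq> nxt (expand n xs) b"
    obtain i where i: "i < N" "a = 2 * i" "nxt zs i \<noteq> nxt xs i" using changed ab(1,3) setx by auto
    obtain j where j: "j < N" "b = 2 * j" "nxt zs j \<noteq> nxt xs j" using changed ab(2,4) setx by auto
    have setxs: "set xs = {..<N}" using xs by (simp add: tours_def)
    have "\<forall>a\<in>set xs. \<forall>b\<in>set xs. nxt zs a \<noteq> nxt xs a \<longrightarrow> nxt zs a = nxt xs b \<longrightarrow> P (2 * a) = P (2 * b)"
    proof (intro ballI impI)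
      fix a b assume ab: "a \<in> set xs" "b \<in> set xs" "nxt zs a \<noteq> nxt xs a" "nxt zs a = nxt xs b"
      then have l: "a < N" "b < N" "2 * a < n" "2 * b < n" using setxs less by auto
      have "nxt (expand n zs) (2 * a) \<noteq> nxt (expand n xs) (2 * a)"
        using ab(3) l lab_eq[OF zs xs l(1,1)] ex[OF l(3)] ez[OF l(3)] by simp
      moreover have "nxt (expand n zs) (2 * a) = nxt (expand n xs) (2 * b)"
        using ab(4) l ex[OF l(4)] ez[OF l(3)] by simp
      ultimately show "P (2 * a) = P (2 * b)" using P l setx(2) by simp
    qed
    note const = adj[unfolded adj_def, THEN spec, of "\<lambda>a. P (2 * a)", THEN mp, OF this, rule_format]
    show "P a = P b" unfolding i(2) j(2) by (rule const) (use i j setxs in simp_all)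
  qed
  have odd_eq: "nxt (expand n zs) (2 * l + 1) = nxt (expand n xs) (2 * l + 1)" if "2 * l + 1 < n" for l
    using ex[OF that] ez[OF that] by simp
  have heads: "nxt (expand n zs) (nxt (expand n xs) a) = nxt (expand n xs) (nxt (expand n xs) a) \<and>
      nxt (expand n zs) (nxt (expand n zs) a) = nxt (expand n xs) (nxt (expand n zs) a)"
    if a: "a < n" "nxt (expand n zs) a \<noteq> nxt (expand n xs) a" for a
  proof -
    obtain i where i: "i < N" "a = 2 * i" using changed[OF a] by blast
    have lx: "lab N (nxt xs i) < N" "lab N (nxt zs i) < N" 
      using lab_less tours_nxt_less[OF xs i(1)] tours_nxt_less[OF zs i(1)] by auto
    then have "2 * lab N (nxt xs i) + 1 < n" "2 * lab N (nxt zs i) + 1 < n" using N(1) by linarith+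
    from this[THEN odd_eq] show ?thesis using ex[OF a(1)] ez[OF a(1)] i by simp
  qed
  assume "perfect_2_matching n S" "cycle_edges (expand n xs) \<inter> cycle_edges (expand n zs) \<subseteq> S"
      "S \<subseteq> cycle_edges (expand n xs) \<union> cycle_edges (expand n zs)"
  then show "S = cycle_edges (expand n xs) \<or> S = cycle_edges (expand n zs)"
    using adj_imp_between[OF setx(1) setz(1) setx(2) setz(2) _ adj' heads] N by simp
qed

text \<open>A matching that misses an inner edge forgoes \<open>big_cost\<close>, and one with a
  foreign edge pays it; both end up above the reference tour. In every other case the arcs describe
  an injective assignment of labels, possibly with several cycles, and the identity is the
  lexicographically least of these.\<close>

lemma optimal_2_matching:
  assumes T: "perfect_2_matching n T" and ne: "T \<noteq> cycle_edges (expand n [0..<N])"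
  shows "sum (edge_cost n) (cycle_edges (expand n [0..<N])) < sum (edge_cost n) T"
proof -
  let ?F = "fixed_edges n" and ?H = "big_cost N" and ?O = "cycle_edges (expand n [0..<N])"
  let ?A = "(\<lambda>i. arc_edge i i) ` {..<N}"
  have lab: "lab N (nxt [0..<N] i) = i" if "i < N" for i using that by (simp add: nxt_upt lab_Suc_mod)
  have "(\<lambda>i. arc_edge i (lab N (nxt [0..<N] i))) ` {..<N} = ?A" by (intro image_cong) (auto simp: lab)
  then have O: "?O = ?F \<union> ?A" "?F \<inter> ?A = {}" using cycle_edges_expand[OF upt_tours] by auto
  have cO: "sum (edge_cost n) ?O = - int (card ?F) * ?H + ?H - 1"
    unfolding sum_edge_cost_expand[OF upt_tours] sum_edge_cost_fixed using lab by (simp add: big_cost_def)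
  have finT: "finite T" using T finite_complete_edges finite_subset by (auto simp: perfect_2_matching_def)
  have split: "sum (edge_cost n) T = sum (edge_cost n) (T \<inter> ?F) + sum (edge_cost n) (T - ?F)"
    using sum.Int_Diff[OF finT] by blast
  have outside: "0 \<le> edge_cost n e" "edge_cost n e < ?H \<Longrightarrow> \<exists>i<N. \<exists>j<N. e = arc_edge i j" if "e \<notin> ?F" for e
    using that big_cost_pos[of N] by (auto simp: edge_cost_def Let_def N(1)[symmetric] split: if_splits)
  have inside: "sum (edge_cost n) (T \<inter> ?F) = - int (card (T \<inter> ?F)) * ?H"
  proof -
    have "sum (edge_cost n) (T \<inter> ?F) = (\<Sum>e\<in>T \<inter> ?F. - ?H)"
      by (intro sum.cong refl) (auto simp only: edge_cost_def Let_def N(1)[symmetric] if_True Int_iff)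
    then show ?thesis by simp
  qed
  have nonneg: "0 \<le> sum (edge_cost n) (T - ?F)" using outside by (intro sum_nonneg) auto
  note H = big_cost_pos[of N]
  show ?thesis
  proof (cases "?F \<subseteq> T")
    case False
    then have "card (T \<inter> ?F) < card ?F" using finite_fixed by (intro psubset_card_mono) auto
    then have "int (card (T \<inter> ?F)) * ?H \<le> (int (card ?F) - 1) * ?H" using H by (intro mult_right_mono) auto
    then show ?thesis unfolding cO split inside using nonneg H by (simp add: algebra_simps)
  next
    case F: True
    then have TF: "T \<inter> ?F = ?F" by blast
    show ?thesis
    proof (cases "\<exists>e\<in>T - ?F. ?H \<le> edge_cost n e")
      case True
      then obtain e where "e \<in> T - ?F" "?H \<le> edge_cost n e" by blast
      moreover from this have "edge_cost n e \<le> sum (edge_cost n) (T - ?F)"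
        using finT outside by (intro member_le_sum) auto
      ultimately show ?thesis unfolding cO split TF sum_edge_cost_fixed by linarith
    next
      case False
      then have arcs: "\<exists>i<N. \<exists>j<N. e = arc_edge i j" if "e \<in> T - ?F" for e using that outside(2)[of e] by force
      \<comment> \<open>The number of inner edges at \<open>v\<close> is read off from
        \<open>?O\<close>, which contains the same inner edges, has degree two and has exactly one
        arc edge at \<open>v\<close>.\<close>
      have deg: "card {e \<in> T - ?F. v \<in> e} = 1" if v: "v < 2 * N" for v
      proof -
        have "v < n" using v N by linarith
        have sp: "card {e \<in> M. v \<in> e} = card {e \<in> ?F. v \<in> e} + card {e \<in> M - ?F. v \<in> e}"
          if "finite M" "?F \<subseteq> M" for M
        proof -
          have "{e \<in> M. v \<in> e} = {e \<in> ?F. v \<in> e} \<union> {e \<in> M - ?F. v \<in> e}" using that(2) by blast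
          then show ?thesis using that(1) finite_fixed by (simp add: card_Un_disjoint disjoint_iff)
        qed
        have "?O - ?F = ?A" using O by blast
        moreover have "{e \<in> ?A. v \<in> e} = {arc_edge (v div 2) (v div 2)}"
          using v by (auto simp: arc_edge_def)
        moreover have "perfect_2_matching n ?O"
          using cycle_edges_perfect expand_tour[OF N upt_tours] N by simp
        moreover have "finite ?O" by (simp add: cycle_edges_def)
        ultimately have "2 = card {e \<in> ?F. v \<in> e} + 1"
          using sp[of ?O] \<open>v < n\<close> O(1) by (simp add: perfect_2_matching_def)
        then show ?thesis using sp[OF finT F] T \<open>v < n\<close> by (simp add: perfect_2_matching_def)
      qed
      have "\<exists>j<N. {e \<in> T - ?F. 2 * i \<in> e} = {arc_edge i j}" if "i < N" for i
      proof -
        have "card {e \<in> T - ?F. 2 * i \<in> e} = 1" by (rule deg) (use that in simp)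
        then obtain e where e: "{e \<in> T - ?F. 2 * i \<in> e} = {e}" by (rule card_1_singletonE)
        then have "e \<in> T - ?F" "2 * i \<in> e" by blast+
        then show ?thesis using arcs[of e] arc_mem(1)[of i] e by auto
      qed
      then obtain s where s: "\<And>i. i < N \<Longrightarrow> s i < N" "\<And>i. i < N \<Longrightarrow> {e \<in> T - ?F. 2 * i \<in> e} = {arc_edge i (s i)}" by metis
      have TS: "T - ?F = (\<lambda>i. arc_edge i (s i)) ` {..<N}"
      proof
        show "T - ?F \<subseteq> (\<lambda>i. arc_edge i (s i)) ` {..<N}"
        proof
          fix e assume e: "e \<in> T - ?F"
          then obtain i j where ij: "i < N" "e = arc_edge i j" using arcs by blast
          then have "e \<in> {e \<in> T - ?F. 2 * i \<in> e}" using e arc_mem(1)[of i i j] by blast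
          then show "e \<in> (\<lambda>i. arc_edge i (s i)) ` {..<N}" using s(2)[OF ij(1)] ij(1) by auto
        qed
        show "(\<lambda>i. arc_edge i (s i)) ` {..<N} \<subseteq> T - ?F" using s(2) by blast
      qed
      have mem: "arc_edge i (s i) \<in> T - ?F" if "i < N" for i
        unfolding TS by (rule imageI) (use that in simp)
      have s_inj: "i = j" if ij: "i < N" "j < N" "s i = s j" for i j
      proof -
        have "card {e \<in> T - ?F. 2 * s i + 1 \<in> e} = 1" by (rule deg) (use s(1)[OF ij(1)] in simp)
        then obtain e where e: "{e \<in> T - ?F. 2 * s i + 1 \<in> e} = {e}" by (rule card_1_singletonE)
        have "2 * s i + 1 \<in> arc_edge i (s i)" "2 * s i + 1 \<in> arc_edge j (s j)" using ij(3) by (simp_all add: arc_mem)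
        then have "arc_edge i (s i) \<in> {e}" "arc_edge j (s j) \<in> {e}" using mem[OF ij(1)] mem[OF ij(2)] unfolding e[symmetric] by blast+
        then have "arc_edge i (s i) = arc_edge j (s j)" by simp
        then show ?thesis by (simp add: arc_inject)
      qed
      have cost: "sum (edge_cost n) T = sum (edge_cost n) ?F + int (\<Sum>i<N. s i * N ^ (N - i))"
      proof -
        have "?F \<inter> (\<lambda>i. arc_edge i (s i)) ` {..<N} = {}" unfolding TS[symmetric] by blast
        then show ?thesis unfolding split TF TS using sum_edge_cost_arcs[of s] s(1) by simp
      qed
      have "\<exists>i<N. s i \<noteq> i"
      proof (rule ccontr)
        assume "\<not> (\<exists>i<N. s i \<noteq> i)"
        then have "(\<lambda>i. arc_edge i (s i)) ` {..<N} = ?A" by (intro image_cong) auto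
        then have "T = ?O" using O(1) TS Un_Diff_cancel[of ?F T] F by (simp add: Un_absorb1)
        then show False using ne by contradiction
      qed
      then obtain i where i: "i < N" "s i \<noteq> i" "\<And>j. j < i \<Longrightarrow> s j = j"
        using exists_least_iff[of "\<lambda>i. i < N \<and> s i \<noteq> i"] by (metis order.strict_trans)
      \<comment> \<open>Values below \<open>i\<close> are taken by the smaller indices, so
        injectivity leaves only a larger value at the first deviation.\<close>
      have "i < s i" using i s_inj[of "s i" i] by (metis linorder_neqE_nat order.strict_trans)
      then have "(\<Sum>j<N. j * N ^ (N - j)) < (\<Sum>j<N. s j * N ^ (N - j))"
        using lex_sum_less[OF i(1), of "\<lambda>j. j" s] i by simp
      then have "int (\<Sum>j<N. lab N (nxt [0..<N] j) * N ^ (N - j)) < int (\<Sum>j<N. s j * N ^ (N - j))"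
        unfolding of_nat_less_iff using lab by simp
      then show ?thesis unfolding cost sum_edge_cost_expand[OF upt_tours] by linarith
    qed
  qed
qed

end

section \<open>Monotone paths on both polytopes\<close>

text \<open>Adjacency and optimality among all perfect 2-matchings restrict to the tours, so one
  list of tours and one cost serve both polytopes.\<close>

lemma monotone_path_perfect_and_tour:
  fixes c :: "nat set \<Rightarrow> int"
  assumes Ms: "Ms \<noteq> []" "\<And>M. M \<in> set Ms \<Longrightarrow> tour n M"
    and steps: "successively (\<lambda>M M'. (\<forall>S. perfect_2_matching n S \<longrightarrow> M \<inter> M' \<subseteq> S \<longrightarrow> S \<subseteq> M \<union> M' \<longrightarrow> S = M \<or> S = M') \<and> sum c M' < sum c M) Ms"
    and opt: "\<And>M. perfect_2_matching n M \<Longrightarrow> M \<noteq> last Ms \<Longrightarrow> sum c (last Ms) < sum c M"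
  shows "monotone_path (perfect_2_matching_polytope n) (map incidence_vec Ms)"
    and "monotone_path (tsp_polytope n) (map incidence_vec Ms)"
proof -
  show "monotone_path (perfect_2_matching_polytope n) (map incidence_vec Ms)"
    unfolding perfect_2_matching_polytope_def
    by (rule monotone_path_incidence[OF finite_complete_edges perfect_subset Ms(1), where c = c])
      (use Ms(2) tour_perfect opt in \<open>auto intro: successively_mono[OF steps]\<close>)
  have sub: "{M. tour n M} \<subseteq> Pow (complete_edges n)" using tour_perfect perfect_subset by blast
  have tour_steps: "successively (\<lambda>M M'. (\<forall>S\<in>{M. tour n M}. M \<inter> M' \<subseteq> S \<longrightarrow> S \<subseteq> M \<union> M' \<longrightarrow> S = M \<or> S = M') \<and>
      sum c M' < sum c M) Ms"
    by (rule successively_mono[OF steps]) (use tour_perfect in blast)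
  show "monotone_path (tsp_polytope n) (map incidence_vec Ms)"
    unfolding tsp_polytope_def
    by (rule monotone_path_incidence[OF finite_complete_edges sub Ms(1) _ tour_steps])
      (use Ms(2) tour_perfect opt in auto)
qed

lemma long_monotone_path:
  assumes "8 \<le> n div 2"
  shows "\<exists>p. monotone_path (perfect_2_matching_polytope n) p \<and> monotone_path (tsp_polytope n) p \<and> fact (n div 2 - 7) \<le> path_len p"
proof -
  define N where "N = n div 2"
  have N: "N = n div 2" "2 \<le> N" "3 \<le> N" "8 \<le> N" using assms by (auto simp: N_def)
  obtain L xs zs where walk: "path_bound N \<le> L" "(step N ^^ L) xs zs" "xs \<in> tours N" "zs \<in> tours N" "agree N zs [0..<N]"
    using long_walk[OF N(3)] by blast
  obtain f where f: "f 0 = xs" "f L = zs" "\<And>i. i < L \<Longrightarrow> step N (f i) (f (Suc i))"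
    using walk(2) by (auto simp: relpowp_fun_conv)
  define g where "g i = cycle_edges (expand n (f i))" for i
  define Ms where "Ms = map g [0..<Suc L]"
  have tours: "f i \<in> tours N" if "i \<le> L" for i
    using f(1) f(3)[of "i - 1"] walk(3) that by (cases i) (auto simp: step_def)
  have tour: "tour n (g i)" if "i \<le> L" for i
    unfolding g_def using tour_cycle_edges expand_tour[OF N(1,2) tours[OF that]] N by simp
  \<comment> \<open>The walk ends in a list with the successors of \<open>[0..<N]\<close>, possibly
    a rotation of it; the edges depend on the successors only.\<close>
  have expand_eq: "cycle_edges (expand n zs) = cycle_edges (expand n [0..<N])"
  proof -
    have "(\<lambda>i. arc_edge i (lab N (nxt zs i))) ` {..<N} = (\<lambda>i. arc_edge i (lab N (nxt [0..<N] i))) ` {..<N}"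
      using walk(5) by (intro image_cong) (auto simp: agree_def)
    then show ?thesis
      using cycle_edges_expand(1)[OF N(1,2) walk(4)] cycle_edges_expand(1)[OF N(1,2) upt_tours] by simp
  qed
  have last: "last Ms = cycle_edges (expand n [0..<N])" by (simp add: Ms_def g_def f(2) expand_eq)
  have steps: "successively (\<lambda>M M'. (\<forall>S. perfect_2_matching n S \<longrightarrow> M \<inter> M' \<subseteq> S \<longrightarrow> S \<subseteq> M \<union> M' \<longrightarrow> S = M \<or> S = M') \<and>
      sum (edge_cost n) M' < sum (edge_cost n) M) Ms"
    unfolding Ms_def successively_map successively_conv_nth
    using step_imp_edge[OF N(1,2) f(3)] by (auto simp: g_def simp del: upt_Suc)
  have "monotone_path (perfect_2_matching_polytope n) (map incidence_vec Ms)"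
    "monotone_path (tsp_polytope n) (map incidence_vec Ms)"
    by (rule monotone_path_perfect_and_tour[OF _ _ steps];
        use tour optimal_2_matching[OF N(1,2)] last in \<open>auto simp: Ms_def less_Suc_eq_le simp del: upt_Suc\<close>)+
  moreover have "path_len (map incidence_vec Ms) = L" by (simp add: path_len_def Ms_def)
  ultimately show ?thesis using fact_le_path_bound[OF N(4)] walk(1) N(1) by (metis order.trans)
qed

text \<open>Covers the small \<open>n\<close> for which the walk has no guaranteed length.
  Exchanging the nodes 1 and 2 alters the tour along the alternating cycle 0, 1, 3, 2, and the
  shared edges at 0, 1 and 2 leave no further choice. A fourth node is essential: K_3 has only one
  tour.\<close>

lemma short_monotone_path:
  assumes n: "4 \<le> n"
  shows "\<exists>p. monotone_path (perfect_2_matching_polytope n) p \<and> monotone_path (tsp_polytope n) p \<and> path_len p = 1"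
proof -
  let ?ys = "[0..<n]" and ?zs = "[0, 2, 1] @ [3..<n]"
  let ?T = "cycle_edges ?ys" and ?T' = "cycle_edges ?zs"
  have sets: "distinct ?ys" "set ?ys = {..<n}" "distinct ?zs" "set ?zs = {..<n}" using n by auto
  have tours: "tour n ?T" "tour n ?T'"
    using tour_cycle_edges[OF sets(1,2)] tour_cycle_edges[OF sets(3,4)] n by auto
  note perf = tours[THEN tour_perfect]
  have ny: "nxt ?ys a = Suc a mod n" if "a < n" for a using nxt_upt[OF that] .
  have nz: "nxt ?zs a = (if a = 0 then 2 else if a = 2 then 1 else if a = 1 then 3 else Suc a mod n)" if "a < n" for a
  proof -
    consider "a = 0" | "a = 2" | "a = 1" | "3 \<le> a" by linarith
    then show ?thesis
    proof cases
      case 4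
      have "?zs ! a = a" using 4 that by (simp add: nth_Cons nth_append numeral_eq_Suc split: nat.split)
      then have "nxt ?zs a = ?zs ! (Suc a mod n)" using nxt_nth[OF sets(3), of a] that n by simp
      also have "\<dots> = Suc a mod n"
        using 4 that by (cases "Suc a = n") (auto simp: nth_Cons nth_append numeral_eq_Suc split: nat.split)
      finally show ?thesis using 4 by simp
    qed (use n in \<open>auto simp: nxt_def upt_rec[of 3]\<close>)
  qed
  define K where "K = insert {1, 2} ((\<lambda>a. {a, Suc a mod n}) ` {3..<n})"
  have upto: "{..<n} = {0, 1, 2} \<union> {3..<n}" using n by auto
  have T: "?T = K \<union> {{0, 1}, {2, 3}}"
  proof -
    have "(\<lambda>a. {a, nxt ?ys a}) ` {3..<n} = (\<lambda>a. {a, Suc a mod n}) ` {3..<n}" using ny by (intro image_cong) auto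
    then show ?thesis unfolding K_def cycle_edges_def sets(2) upto image_Un using ny n by auto
  qed
  have T': "?T' = K \<union> {{0, 2}, {1, 3}}"
  proof -
    have "(\<lambda>a. {a, nxt ?zs a}) ` {3..<n} = (\<lambda>a. {a, Suc a mod n}) ` {3..<n}" using nz by (intro image_cong) auto
    then show ?thesis unfolding K_def cycle_edges_def sets(4) upto image_Un using nz n by auto
  qed
  have K: "0 \<in> e \<Longrightarrow> e = {n - 1, 0}" "1 \<in> e \<Longrightarrow> e = {1, 2}" "2 \<in> e \<Longrightarrow> e = {1, 2}" if "e \<in> K" for e
    using that n by (auto simp: K_def mod_Suc split: if_splits)
  have K0: "{n - 1, 0} \<in> K" unfolding K_def using n by (intro insertI2 image_eqI[of _ _ "n - 1"]) auto
  have between: "S = ?T \<or> S = ?T'" if S: "perfect_2_matching n S" "?T \<inter> ?T' \<subseteq> S" "S \<subseteq> ?T \<union> ?T'" for S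
  proof -
    have KS: "K \<subseteq> S" using S(2) unfolding T T' by blast
    have K12: "{1, 2} \<in> K" by (simp add: K_def)
    have S4: "S \<subseteq> K \<union> {{0, 1}, {2, 3}, {0, 2}, {1, 3}}" using S(3) unfolding T T' by blast
    have at: "{e \<in> S. v \<in> e} \<subseteq> insert f {e. v \<in> e \<and> (e = {0, 1} \<or> e = {2, 3} \<or> e = {0, 2} \<or> e = {1, 3})}"
      if "\<And>e. e \<in> K \<Longrightarrow> v \<in> e \<Longrightarrow> e = f" for v f
      using S4 that by blast
    have "{0, 1} \<in> S \<longleftrightarrow> {0, 2} \<notin> S"
    proof (rule exactly_one_edge[OF S(1)])
      show "{e \<in> S. 0 \<in> e} \<subseteq> {{n - 1, 0}, {0, 1}, {0, 2}}" by (rule order.trans[OF at[OF K(1)]]) auto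
    qed (use K0 KS n in \<open>auto simp: doubleton_eq_iff\<close>)
    moreover have "{0, 1} \<in> S \<longleftrightarrow> {1, 3} \<notin> S"
    proof (rule exactly_one_edge[OF S(1)])
      show "{e \<in> S. 1 \<in> e} \<subseteq> {{1, 2}, {0, 1}, {1, 3}}" by (rule order.trans[OF at[OF K(2)]]) auto
    qed (use K12 KS n in \<open>auto simp: doubleton_eq_iff\<close>)
    moreover have "{2, 3} \<in> S \<longleftrightarrow> {0, 2} \<notin> S"
    proof (rule exactly_one_edge[OF S(1)])
      show "{e \<in> S. 2 \<in> e} \<subseteq> {{1, 2}, {2, 3}, {0, 2}}" by (rule order.trans[OF at[OF K(3)]]) auto
    qed (use K12 KS n in \<open>auto simp: doubleton_eq_iff\<close>)
    ultimately show ?thesis unfolding T T' using KS S4 by blast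
  qed
  \<comment> \<open>Any other matching lacks an edge of \<open>?T\<close> or contains one outside
    it; each such edge raises the cost by one.\<close>
  define c :: "nat set \<Rightarrow> int" where "c e = (if e \<in> ?T then - 1 else 1)" for e
  have opt: "sum c ?T < sum c M" if M: "perfect_2_matching n M" "M \<noteq> ?T" for M
  proof -
    have fin: "finite M" "finite ?T"
      using M(1) perf(1) finite_complete_edges finite_subset by (auto simp: perfect_2_matching_def)
    have "sum c M = sum c (M \<inter> ?T) + sum c (M - ?T)" using sum.Int_Diff[OF fin(1)] by blast
    then have "sum c M = int (card (M - ?T)) - int (card (M \<inter> ?T))" by (simp add: c_def)
    moreover have "sum c ?T = - int (card ?T)" by (simp add: c_def)
    moreover have "card (M \<inter> ?T) < card ?T \<or> 0 < card (M - ?T)"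
    proof (cases "?T \<subseteq> M")
      case True
      then have "M - ?T \<noteq> {}" using M(2) by blast
      then show ?thesis using fin(1) by (simp add: card_gt_0_iff)
    next
      case False
      then show ?thesis using fin(2) by (intro disjI1 psubset_card_mono) auto
    qed
    moreover have "card (M \<inter> ?T) \<le> card ?T" using fin(2) by (intro card_mono) auto
    ultimately show ?thesis by linarith
  qed
  have "{0, 2} \<notin> ?T"
    unfolding T using K(1)[of "{0, 2}"] n by (auto simp: doubleton_eq_iff)
  then have ne: "?T' \<noteq> ?T" using T' by blast
  have steps: "successively (\<lambda>M M'. (\<forall>S. perfect_2_matching n S \<longrightarrow> M \<inter> M' \<subseteq> S \<longrightarrow> S \<subseteq> M \<union> M' \<longrightarrow> S = M \<or> S = M') \<and>
      sum c M' < sum c M) [?T', ?T]"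
    using between opt[OF perf(2) ne] by (simp add: Int_commute Un_commute) blast
  have "monotone_path (perfect_2_matching_polytope n) (map incidence_vec [?T', ?T])"
    "monotone_path (tsp_polytope n) (map incidence_vec [?T', ?T])"
    by (rule monotone_path_perfect_and_tour[OF _ _ steps]; use tours opt in auto)+
  then show ?thesis by (intro exI[of _ "map incidence_vec [?T', ?T]"]) (simp add: path_len_def)
qed

section \<open>Comparison of the factorial with powers of the golden ratio\<close>

text \<open>The square of the golden ratio is itself plus one, hence at most 3, and an odd exponent
  leaves one factor of at most 2. Crude estimates suffice against a factorial.\<close>

lemma golden_ratio_power_le: "golden_ratio ^ n \<le> 2 * 3 ^ (n div 2)"
proof -
  have s: "sqrt 5 \<le> 3" by (rule real_le_lsqrt) auto
  have g: "0 \<le> golden_ratio" "golden_ratio \<le> 2" using s by (auto simp: golden_ratio_def)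
  have "golden_ratio\<^sup>2 = golden_ratio + 1"
    by (simp add: golden_ratio_def power2_eq_square field_simps)
  then have sq: "golden_ratio\<^sup>2 \<le> 3" using g by simp
  have "golden_ratio ^ n = (golden_ratio\<^sup>2) ^ (n div 2) * golden_ratio ^ (n mod 2)"
    by (simp flip: power_mult power_add)
  also have "\<dots> \<le> 3 ^ (n div 2) * 2"
  proof (rule mult_mono)
    show "(golden_ratio\<^sup>2) ^ (n div 2) \<le> 3 ^ (n div 2)" using sq by (intro power_mono) auto
    show "golden_ratio ^ (n mod 2) \<le> 2" using g by (cases "even n") (auto simp: odd_iff_mod_2_eq_one)
  qed (use g in auto)
  finally show ?thesis by simp
qed

text \<open>The quotient of \<open>3 ^ k\<close> and \<open>fact k\<close> peaks at 9/2 for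
  \<open>k = 2\<close> and \<open>k = 3\<close>, hence the factor 5. From \<open>k = 2\<close> on, a
  step multiplies the right-hand side by at least 3.\<close>

lemma power_3_le_fact: "3 ^ k \<le> (5 * fact k :: nat)"
proof (induction k)
  case (Suc k)
  consider "k = 0" | "k = 1" | "2 \<le> k" by linarith
  then show ?case
  proof cases
    case 3
    then have "3 * 3 ^ k \<le> Suc k * (5 * fact k :: nat)" using Suc by (intro mult_le_mono) auto
    then show ?thesis by (simp add: algebra_simps)
  qed (auto simp: numeral_eq_Suc)
qed simp

theorem theorem1p7:
  shows "\<exists>C::real. C > 0 \<and> (\<forall>n::nat. n \<ge> 4 \<longrightarrow>
     (\<exists>p. monotone_path (perfect_2_matching_polytope n) p \<and> real (path_len p) > C * golden_ratio ^ n) \<and>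
     (\<exists>p. monotone_path (tsp_polytope n) p \<and> real (path_len p) > C * golden_ratio ^ n))"
proof (intro exI[of _ "1 / 30000"] conjI allI impI)
  fix n :: nat
  assume n: "4 \<le> n"
  let ?k = "n div 2 - 7"
  have "\<exists>p. monotone_path (perfect_2_matching_polytope n) p \<and> monotone_path (tsp_polytope n) p \<and> fact ?k \<le> path_len p"
  proof (cases "8 \<le> n div 2")
    case True
    then show ?thesis by (rule long_monotone_path)
  next
    case False
    then show ?thesis using short_monotone_path[OF n] by fastforce
  qed
  then obtain p where p: "monotone_path (perfect_2_matching_polytope n) p" "monotone_path (tsp_polytope n) p"
    "fact ?k \<le> path_len p" by blast
  have "golden_ratio ^ n \<le> 2 * 3 ^ (n div 2)" by (rule golden_ratio_power_le)
  \<comment> \<open>Only an inequality, because the truncated \<open>?k\<close> is 0 when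
    \<open>n div 2 < 7\<close>.\<close>
  also have "(3::real) ^ (n div 2) \<le> 3 ^ (7 + ?k)" by (intro power_increasing) auto
  also have "\<dots> = 3 ^ 7 * real (3 ^ ?k)" by (simp add: power_add)
  also have "real (3 ^ ?k) \<le> real (5 * fact ?k)" using power_3_le_fact of_nat_mono by blast
  also have "\<dots> \<le> real (5 * path_len p)" using p(3) by (intro of_nat_mono) simp
  \<comment> \<open>The constant is \<open>2 * 3 ^ 7 * 5\<close>: the odd exponent, the shift by 7
    and the factor in front of the factorial. Since 30000 is larger, a positive length makes the
    final inequality strict.\<close>
  finally have "golden_ratio ^ n \<le> 21870 * real (path_len p)" by simp
  moreover have "0 < path_len p" using p(3) fact_gt_zero[of ?k, where 'a = nat] by linarith
  ultimately have "1 / 30000 * golden_ratio ^ n < real (path_len p)" by simp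
  then show "\<exists>p. monotone_path (perfect_2_matching_polytope n) p \<and> 1 / 30000 * golden_ratio ^ n < real (path_len p)"
    "\<exists>p. monotone_path (tsp_polytope n) p \<and> 1 / 30000 * golden_ratio ^ n < real (path_len p)"
    using p by blast+
qed simp

end
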